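(* Let $n\ge 1$ and $M\ge 2$ be integers. For every prime power $q$, $$\frac{|\mathrm{GL}(n,q)^M|}{|\mathrm{GL}(n,q)|}=\sum_{\substack{\lambda\vdash n\\ \lambda=1^{m_1}2^{m_2}\cdots i^{m_i}\cdots}}\ \prod_{i}\frac{1}{m_i!\,i^{m_i}\,(M,q^i-1)^{m_i}}+\mathcal O(q^{-1}),$$ where the constant implied by $\mathcal O$ does not depend on $q$.
   Context: $\mathrm{GL}(n,q)$ is the general linear group over the field $\mathbb F_q$ with $q$ elements, and $\mathrm{GL}(n,q)^M=\{x^M:x\in \mathrm{GL}(n,q)\}$. The sum is over all partitions $\lambda$ of $n$, written in power notation: $m_i\ge 0$ is the number of parts of $\lambda$ equal to $i$. $(a,b)$ is the greatest common divisor. *)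

theory Defs
  imports
    "HOL-Algebra.Ring"
    "HOL-Library.Multiset"
    "HOL-Number_Theory.Prime_Powers"
    "Jordan_Normal_Form.Matrix"
begin

(* The statement bounds an error uniformly over all finite fields, so the field has to be an
   object (a record) and not a type of class field.  Only the type of matrices, their dimensions
   and entries are taken from Jordan_Normal_Form: its product, unit matrix and inverse refer to the
   arithmetic of a type class, which is absent here. *)

definition mat_monoid :: "('a, 'b) ring_scheme \<Rightarrow> nat \<Rightarrow> 'a mat monoid" where
  "mat_monoid F n =
     \<lparr>carrier = {A \<in> carrier_mat n n. \<forall>i<n. \<forall>j<n. A $$ (i, j) \<in> carrier F},
      mult = (\<lambda>A B. mat n n (\<lambda>(i, j). \<Oplus>\<^bsub>F\<^esub>k\<in>{..<n}. A $$ (i, k) \<otimes>\<^bsub>F\<^esub> B $$ (k, j))),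
      one = mat n n (\<lambda>(i, j). if i = j then \<one>\<^bsub>F\<^esub> else \<zero>\<^bsub>F\<^esub>)\<rparr>"

definition GL :: "nat \<Rightarrow> ('a, 'b) ring_scheme \<Rightarrow> 'a mat monoid" where
  "GL n F = units_of (mat_monoid F n)"

definition power_image :: "('g, 'h) monoid_scheme \<Rightarrow> nat \<Rightarrow> 'g set" where
  "power_image G M = {x [^]\<^bsub>G\<^esub> M | x. x \<in> carrier G}"

(* A partition is the multiset of its (positive) parts; m_i is the multiplicity "count \<nu> i". *)
definition partitions_of :: "nat \<Rightarrow> nat multiset set" where
  "partitions_of n = {\<nu>. 0 \<notin># \<nu> \<and> \<Sum>\<^sub># \<nu> = n}"

lemma size_le_sum_mset:
  fixes \<nu> :: "nat multiset"
  assumes "0 \<notin># \<nu>"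
  shows "size \<nu> \<le> \<Sum>\<^sub># \<nu>"
  using assms by (induction \<nu>) auto

lemma finite_partitions_of [simp]: "finite (partitions_of n)"
proof (rule finite_subset)
  show "partitions_of n \<subseteq> mset ` {xs. set xs \<subseteq> {..n} \<and> length xs \<le> n}"
  proof
    fix \<nu> assume l: "\<nu> \<in> partitions_of n"
    obtain xs where xs: "\<nu> = mset xs" by (metis ex_mset)
    have "length xs \<le> n"
      using l size_le_sum_mset[of \<nu>] xs by (auto simp: partitions_of_def)
    moreover have "set xs \<subseteq> {..n}"
      using l member_le_sum_list[of _ xs] xs by (auto simp: partitions_of_def sum_mset_sum_list)
    ultimately show "\<nu> \<in> mset ` {xs. set xs \<subseteq> {..n} \<and> length xs \<le> n}"
      using xs by auto
  qed
  show "finite (mset ` {xs. set xs \<subseteq> {..n} \<and> length xs \<le> n})"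
    by (intro finite_imageI finite_lists_length_le) auto
qed

lemma monoid_mat_monoid:
  fixes F (structure)
  assumes "ring F"
  shows "monoid (mat_monoid F n)"
proof -
  interpret ring F by fact
  show ?thesis
  proof (rule monoidI)
    fix A B C
    assume "A \<in> carrier (mat_monoid F n)" "B \<in> carrier (mat_monoid F n)"
      "C \<in> carrier (mat_monoid F n)"
    then have cl: "\<And>i j. i < n \<Longrightarrow> j < n \<Longrightarrow> A $$ (i, j) \<in> carrier F"
      "\<And>i j. i < n \<Longrightarrow> j < n \<Longrightarrow> B $$ (i, j) \<in> carrier F"
      "\<And>i j. i < n \<Longrightarrow> j < n \<Longrightarrow> C $$ (i, j) \<in> carrier F"
      by (auto simp: mat_monoid_def)
    have "(\<Oplus>k\<in>{..<n}. (\<Oplus>l\<in>{..<n}. A $$ (i, l) \<otimes> B $$ (l, k)) \<otimes> C $$ (k, j)) =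
          (\<Oplus>l\<in>{..<n}. A $$ (i, l) \<otimes> (\<Oplus>k\<in>{..<n}. B $$ (l, k) \<otimes> C $$ (k, j)))"
      if "i < n" "j < n" for i j
    proof -
      have "(\<Oplus>k\<in>{..<n}. (\<Oplus>l\<in>{..<n}. A $$ (i, l) \<otimes> B $$ (l, k)) \<otimes> C $$ (k, j)) =
            (\<Oplus>k\<in>{..<n}. \<Oplus>l\<in>{..<n}. A $$ (i, l) \<otimes> B $$ (l, k) \<otimes> C $$ (k, j))"
        using cl that by (intro finsum_cong' finsum_ldistr) (auto intro!: finsum_closed)
      also have "\<dots> = (\<Oplus>l\<in>{..<n}. \<Oplus>k\<in>{..<n}. A $$ (i, l) \<otimes> B $$ (l, k) \<otimes> C $$ (k, j))"
      proof -
        have "(\<Oplus>k\<in>S. \<Oplus>l\<in>{..<n}. f k l) = (\<Oplus>l\<in>{..<n}. \<Oplus>k\<in>S. f k l)"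
          if "finite S" "\<And>k l. k \<in> S \<Longrightarrow> l < n \<Longrightarrow> f k l \<in> carrier F" for S :: "nat set" and f
          using that
        proof (induction S rule: finite_induct)
          case empty
          then show ?case by (simp add: finsum_zero)
        next
          case (insert x S)
          have "(\<Oplus>l\<in>{..<n}. \<Oplus>k\<in>insert x S. f k l) = (\<Oplus>l\<in>{..<n}. f x l \<oplus> (\<Oplus>k\<in>S. f k l))"
            using insert by (intro finsum_cong' finsum_insert) (auto intro!: finsum_closed)
          also have "\<dots> = (\<Oplus>l\<in>{..<n}. f x l) \<oplus> (\<Oplus>l\<in>{..<n}. \<Oplus>k\<in>S. f k l)"
            using insert by (intro finsum_addf) (auto intro!: finsum_closed)
          finally show ?case
            using insert by (subst finsum_insert) (auto intro!: finsum_closed)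
        qed
        from this[of "{..<n}" "\<lambda>k l. A $$ (i, l) \<otimes> B $$ (l, k) \<otimes> C $$ (k, j)"]
        show ?thesis using cl that by simp
      qed
      also have "\<dots> = (\<Oplus>l\<in>{..<n}. A $$ (i, l) \<otimes> (\<Oplus>k\<in>{..<n}. B $$ (l, k) \<otimes> C $$ (k, j)))"
      proof (intro finsum_cong' refl)
        fix l assume l: "l \<in> {..<n}"
        have "(\<Oplus>k\<in>{..<n}. A $$ (i, l) \<otimes> B $$ (l, k) \<otimes> C $$ (k, j)) =
              (\<Oplus>k\<in>{..<n}. A $$ (i, l) \<otimes> (B $$ (l, k) \<otimes> C $$ (k, j)))"
          using cl that l by (intro finsum_cong') (auto simp: m_assoc)
        also have "\<dots> = A $$ (i, l) \<otimes> (\<Oplus>k\<in>{..<n}. B $$ (l, k) \<otimes> C $$ (k, j))"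
          using cl that l by (intro finsum_rdistr[symmetric]) auto
        finally show "(\<Oplus>k\<in>{..<n}. A $$ (i, l) \<otimes> B $$ (l, k) \<otimes> C $$ (k, j)) =
              A $$ (i, l) \<otimes> (\<Oplus>k\<in>{..<n}. B $$ (l, k) \<otimes> C $$ (k, j))" .
      qed (use cl that in \<open>auto intro!: finsum_closed\<close>)
      finally show ?thesis .
    qed
    moreover have "(\<Oplus>k\<in>{..<n}. mat n n f $$ (i, k) \<otimes> C $$ (k, j)) = (\<Oplus>k\<in>{..<n}. f (i, k) \<otimes> C $$ (k, j))"
      if "i < n" "j < n" "\<And>i k. i < n \<Longrightarrow> k < n \<Longrightarrow> f (i, k) \<in> carrier F" for i j f
      using that cl by (intro finsum_cong') auto
    moreover have "(\<Oplus>k\<in>{..<n}. A $$ (i, k) \<otimes> mat n n f $$ (k, j)) = (\<Oplus>k\<in>{..<n}. A $$ (i, k) \<otimes> f (k, j))"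
      if "i < n" "j < n" "\<And>i k. i < n \<Longrightarrow> k < n \<Longrightarrow> f (i, k) \<in> carrier F" for i j f
      using that cl by (intro finsum_cong') auto
    ultimately show "A \<otimes>\<^bsub>mat_monoid F n\<^esub> B \<otimes>\<^bsub>mat_monoid F n\<^esub> C =
          A \<otimes>\<^bsub>mat_monoid F n\<^esub> (B \<otimes>\<^bsub>mat_monoid F n\<^esub> C)"
      using cl by (intro eq_matI) (auto simp: mat_monoid_def)
  next
    fix A assume A: "A \<in> carrier (mat_monoid F n)"
    have "(\<Oplus>k\<in>{..<n}. mat n n (\<lambda>(i, j). if i = j then \<one> else \<zero>) $$ (i, k) \<otimes> A $$ (k, j)) = A $$ (i, j)"
      if "i < n" "j < n" for i j
    proof -
      have "(\<Oplus>k\<in>{..<n}. mat n n (\<lambda>(i, j). if i = j then \<one> else \<zero>) $$ (i, k) \<otimes> A $$ (k, j)) =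
            (\<Oplus>k\<in>{..<n}. if i = k then A $$ (k, j) else \<zero>)"
        using A that by (intro finsum_cong') (auto simp: mat_monoid_def)
      also have "\<dots> = A $$ (i, j)"
        using A that by (intro finsum_singleton) (auto simp: mat_monoid_def)
      finally show ?thesis .
    qed
    then show "\<one>\<^bsub>mat_monoid F n\<^esub> \<otimes>\<^bsub>mat_monoid F n\<^esub> A = A"
      using A by (intro eq_matI) (auto simp: mat_monoid_def)
    have "(\<Oplus>k\<in>{..<n}. A $$ (i, k) \<otimes> mat n n (\<lambda>(i, j). if i = j then \<one> else \<zero>) $$ (k, j)) = A $$ (i, j)"
      if "i < n" "j < n" for i j
    proof -
      have "(\<Oplus>k\<in>{..<n}. A $$ (i, k) \<otimes> mat n n (\<lambda>(i, j). if i = j then \<one> else \<zero>) $$ (k, j)) =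
            (\<Oplus>k\<in>{..<n}. if j = k then A $$ (i, k) else \<zero>)"
        using A that by (intro finsum_cong') (auto simp: mat_monoid_def)
      also have "\<dots> = A $$ (i, j)"
        using A that by (intro finsum_singleton) (auto simp: mat_monoid_def)
      finally show ?thesis .
    qed
    then show "A \<otimes>\<^bsub>mat_monoid F n\<^esub> \<one>\<^bsub>mat_monoid F n\<^esub> = A"
      using A by (intro eq_matI) (auto simp: mat_monoid_def)
  qed (auto simp: mat_monoid_def intro!: finsum_closed)
qed

lemma group_GL: "ring F \<Longrightarrow> group (GL n F)"
  unfolding GL_def by (intro monoid.units_group monoid_mat_monoid)

lemma finite_mat_monoid:
  assumes "finite (carrier F)"
  shows "finite (carrier (mat_monoid F n))"
proof (rule finite_subset)
  let ?S = "({..<n} \<times> {..<n}) \<rightarrow>\<^sub>E carrier F"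
  show "carrier (mat_monoid F n) \<subseteq> (\<lambda>f. mat n n f) ` ?S"
  proof
    fix A assume "A \<in> carrier (mat_monoid F n)"
    then show "A \<in> (\<lambda>f. mat n n f) ` ?S"
      by (intro image_eqI[of _ _ "restrict (\<lambda>ij. A $$ ij) ({..<n} \<times> {..<n})"])
         (auto simp: mat_monoid_def intro!: eq_matI)
  qed
  show "finite ((\<lambda>f. mat n n f) ` ?S)"
    using assms by (intro finite_imageI finite_PiE) auto
qed

lemma finite_GL: "finite (carrier F) \<Longrightarrow> finite (carrier (GL n F))"
  unfolding GL_def units_of_carrier Units_def
  by (rule finite_subset[OF _ finite_mat_monoid]) auto

end

theory Submission
  imports Defs "HOL-Algebra.Algebraic_Closure" "HOL-Algebra.Multiplicative_Group"
begin

text \<open>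
  Over the field of order \<open>q\<close>, an invertible matrix with \<open>n\<close> distinct eigenvalues in the algebraic
  closure is determined up to conjugacy by its Frobenius-stable set of eigenvalues, commutes with
  at most \<open>q\<^sup>n\<close> matrices, and is an \<open>M\<close>-th power iff its eigenvalues have \<open>M\<close>-th roots chosen
  compatibly with Frobenius.  The eigenvalue sets of cycle type \<open>\<lambda>\<close> come from tuples with \<open>m\<^sub>i\<close>
  nonzero entries in the field of order \<open>q\<^sup>i\<close>, each set from at most \<open>z(\<lambda>) = \<Prod> m\<^sub>i! i\<^bsup>m\<^sub>i\<^esup>\<close> tuples,
  and all but \<open>O(q\<^bsup>n-1\<^esup>)\<close> of the tuples have pairwise distinct conjugates.

  Only lower bounds are needed.  With \<open>g(\<lambda>) = \<Prod> (M, q\<^sup>i - 1)\<^bsup>m\<^sub>i\<^esup>\<close>, the \<open>M\<close>-th powers and the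
  non-powers obtained in this way have proportions at least \<open>\<Sum> 1 / (z(\<lambda>) g(\<lambda>)) - O(1/q)\<close> and
  \<open>\<Sum> (1 - 1 / g(\<lambda>)) / z(\<lambda>) - O(1/q)\<close>, which add up to \<open>1 - O(1/q)\<close> because \<open>\<Sum> 1 / z(\<lambda>) = 1\<close>.
  So matrices with repeated eigenvalues never have to be counted.
\<close>

section \<open>Polynomial functions over a field\<close>

text \<open>Coordinate r of \<open>act A (vand b)\<close> is the value at \<open>b\<close> of the
  polynomial over \<open>F\<close> whose coefficients form row r of \<open>A\<close>. A matrix is
  thus read as n polynomials of degree less than n, and n distinct evaluation points determine it.
  For a Frobenius-stable set \<open>S\<close> of n points, interpolation yields a matrix for every
  Frobenius-compatible choice of eigenvalues on the columns \<open>vand b\<close>. The companion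
  matrix of \<open>S\<close> arises in this way, and so do its inverse, its M-th roots and whatever
  commutes with it; no determinant appears. The centralizer bound gives each class at least |GL|/q^n
  elements, while type \<lambda> contributes at least about q^n/z(\<lambda>) sets: the powers of q
  cancel. The error constant is n^2 + n. Relative to q^n, at most n/q of the tuples are lost to zero
  entries, and at most 1/q to each of at most n^2 coincidences between conjugates.\<close>

lemma (in ring) eval_map_rev_upt:
  assumes "\<And>i. i < d \<Longrightarrow> c i \<in> carrier R" and "x \<in> carrier R"
  shows "eval (map c (rev [0..<d])) x = (\<Oplus>i\<in>{..<d}. c i \<otimes> x [^] i)"
  using assms(1)
proof (induction d)
  case (Suc d)
  have "(\<Oplus>i\<in>{..<Suc d}. c i \<otimes> x [^] i) = c d \<otimes> x [^] d \<oplus> (\<Oplus>i\<in>{..<d}. c i \<otimes> x [^] i)"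
    unfolding lessThan_Suc using Suc.prems assms(2) by (subst finsum_insert) auto
  then show ?case
    using Suc by simp
qed simp

text \<open>A nonempty normalized coefficient list of length at most \<open>d\<close> has degree
  less than \<open>d\<close>, hence fewer than \<open>d\<close> roots, while \<open>A\<close>
  supplies \<open>d\<close> of them. The uniqueness of interpolation rests on this count.\<close>

lemma (in field) coeffs_zero_if_many_roots:
  fixes c :: "nat \<Rightarrow> 'a"
  assumes c: "\<And>i. i < d \<Longrightarrow> c i \<in> carrier R" and A: "A \<subseteq> carrier R" "d \<le> card A"
    and zero: "\<And>x. x \<in> A \<Longrightarrow> (\<Oplus>i\<in>{..<d}. c i \<otimes> x [^] i) = \<zero>"
    and i: "i < d"
  shows "c i = \<zero>"
proof -
  define p where "p = normalize (map c (rev [0..<d]))"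
  have set: "set (map c (rev [0..<d])) \<subseteq> carrier R"
    using c by auto
  have p: "p \<in> carrier (poly_ring R)"
    unfolding p_def univ_poly_carrier[symmetric] using normalize_gives_polynomial[OF set] .
  have len: "length p \<le> d"
    unfolding p_def using normalize_length_le[of "map c (rev [0..<d])"] by simp
  have "p = []"
  proof (rule ccontr)
    assume ne: "p \<noteq> []"
    have "A \<subseteq> set_mset (roots p)"
    proof
      fix x assume x: "x \<in> A"
      have "eval p x = \<zero>"
        unfolding p_def eval_normalize[OF set subsetD[OF A(1) x]]
        using zero[OF x] A(1) x c by (subst eval_map_rev_upt) auto
      then show "x \<in># roots p"
        using x A(1) ne by (auto simp: roots_mem_iff_is_root[OF p] is_root_def)
    qed
    then have "card A \<le> card (set_mset (roots p))"
      by (intro card_mono) auto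
    also have "\<dots> \<le> size (roots p)"
      unfolding size_multiset_overloaded_eq card_eq_sum
      by (intro sum_mono) (simp add: Suc_le_eq)
    also have "\<dots> \<le> degree p"
      by (rule size_roots_le_degree[OF p])
    finally show False
      using len ne A(2) by (cases p) auto
  qed
  moreover have "set xs \<subseteq> {\<zero>}" if "normalize xs = []" for xs
    using that by (induction xs) (auto split: if_splits)
  ultimately have "set (map c (rev [0..<d])) \<subseteq> {\<zero>}"
    unfolding p_def by blast
  then have "c ` {..<d} \<subseteq> {\<zero>}"
    by (simp add: lessThan_atLeast0)
  then show ?thesis
    using i by (auto simp: image_subset_iff)
qed

lemma (in field) finite_field_pow_card:
  assumes "finite (carrier R)" "x \<in> carrier R"
  shows "x [^] card (carrier R) = x"
proof (cases "x = \<zero>")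
  case True
  then show ?thesis
    using assms zero_closed by (metis card_eq_0_iff empty_iff nat_pow_zero)
next
  case False
  interpret U: group "Multiplicative_Group.mult_of R"
    by (rule field_mult_group)
  have "x [^] (card (carrier R) - 1) = \<one>"
    using U.pow_order_eq_1[of x] assms False by (simp add: order_mult_of Multiplicative_Group.nat_pow_mult_of) (simp add: order_def)
  moreover have "card (carrier R) = Suc (card (carrier R) - 1)"
    using assms by (metis Suc_diff_1 card_gt_0_iff empty_iff)
  ultimately show ?thesis
    using assms by (metis l_one nat_pow_Suc)
qed

text \<open>\<open>m\<close> bounds the number of coefficients, so the degree is less than
  \<open>m\<close>. Speaking of functions keeps sums and products pointwise, and only the degree
  bound has to be tracked.\<close>

definition (in cring) polyfun :: "nat \<Rightarrow> ('a \<Rightarrow> 'a) \<Rightarrow> bool" where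
  "polyfun m f \<longleftrightarrow> (\<exists>c. (\<forall>i<m. c i \<in> carrier R) \<and> (\<forall>x\<in>carrier R. f x = (\<Oplus>i\<in>{..<m}. c i \<otimes> x [^] i)))"

context cring
begin

lemma finsum_lessThan_Suc:
  "(\<And>i. i \<le> m \<Longrightarrow> g i \<in> carrier R) \<Longrightarrow> (\<Oplus>i\<in>{..<Suc m}. g i) = g m \<oplus> (\<Oplus>i\<in>{..<m}. g i)"
  unfolding lessThan_Suc by (subst finsum_insert) auto

lemma finsum_lessThan_Suc_shift:
  assumes "\<And>i. i \<le> m \<Longrightarrow> g i \<in> carrier R"
  shows "(\<Oplus>i\<in>{..<Suc m}. g i) = g 0 \<oplus> (\<Oplus>i\<in>{..<m}. g (Suc i))"
  using assms
proof (induction m)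
  case (Suc m)
  have "(\<Oplus>i\<in>{..<m}. g (Suc i)) \<in> carrier R"
    using Suc.prems by (intro finsum_closed) auto
  moreover have "(\<Oplus>i\<in>{..<Suc m}. g (Suc i)) = g (Suc m) \<oplus> (\<Oplus>i\<in>{..<m}. g (Suc i))"
    using Suc.prems by (intro finsum_lessThan_Suc) auto
  ultimately show ?case
    using Suc by (subst finsum_lessThan_Suc) (auto simp: a_lcomm)
qed (simp add: lessThan_Suc)

lemma polyfun_closed: "polyfun m f \<Longrightarrow> x \<in> carrier R \<Longrightarrow> f x \<in> carrier R"
  unfolding polyfun_def by (auto intro!: finsum_closed)

lemma polyfun_cong:
  "polyfun m f \<Longrightarrow> (\<And>x. x \<in> carrier R \<Longrightarrow> f x = g x) \<Longrightarrow> polyfun m g"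
  unfolding polyfun_def by simp

lemma polyfun_add:
  assumes "polyfun m f" "polyfun m g"
  shows "polyfun m (\<lambda>x. f x \<oplus> g x)"
proof -
  obtain c d where c: "\<forall>i<m. c i \<in> carrier R" "\<forall>x\<in>carrier R. f x = (\<Oplus>i\<in>{..<m}. c i \<otimes> x [^] i)"
    and d: "\<forall>i<m. d i \<in> carrier R" "\<forall>x\<in>carrier R. g x = (\<Oplus>i\<in>{..<m}. d i \<otimes> x [^] i)"
    using assms unfolding polyfun_def by auto
  have "f x \<oplus> g x = (\<Oplus>i\<in>{..<m}. (c i \<oplus> d i) \<otimes> x [^] i)" if "x \<in> carrier R" for x
  proof -
    have "(\<Oplus>i\<in>{..<m}. (c i \<oplus> d i) \<otimes> x [^] i) = (\<Oplus>i\<in>{..<m}. c i \<otimes> x [^] i \<oplus> d i \<otimes> x [^] i)"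
      using c d that by (intro finsum_cong') (auto simp: l_distr)
    then show ?thesis
      using c d that by (subst (asm) finsum_addf) auto
  qed
  then show ?thesis
    unfolding polyfun_def using c d by (intro exI[of _ "\<lambda>i. c i \<oplus> d i"]) auto
qed

lemma polyfun_smult:
  assumes "polyfun m f" "a \<in> carrier R"
  shows "polyfun m (\<lambda>x. a \<otimes> f x)"
proof -
  obtain c where c: "\<forall>i<m. c i \<in> carrier R" "\<forall>x\<in>carrier R. f x = (\<Oplus>i\<in>{..<m}. c i \<otimes> x [^] i)"
    using assms unfolding polyfun_def by auto
  have "a \<otimes> f x = (\<Oplus>i\<in>{..<m}. (a \<otimes> c i) \<otimes> x [^] i)" if "x \<in> carrier R" for x
  proof -
    have "(\<Oplus>i\<in>{..<m}. (a \<otimes> c i) \<otimes> x [^] i) = (\<Oplus>i\<in>{..<m}. a \<otimes> (c i \<otimes> x [^] i))"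
      using c assms that by (intro finsum_cong') (auto simp: m_assoc)
    then show ?thesis
      using c assms that by (subst (asm) finsum_rdistr[symmetric]) auto
  qed
  then show ?thesis
    unfolding polyfun_def using c assms by (intro exI[of _ "\<lambda>i. a \<otimes> c i"]) auto
qed

lemma polyfun_shift:
  assumes "polyfun m f"
  shows "polyfun (Suc m) (\<lambda>x. x \<otimes> f x)"
proof -
  obtain c where c: "\<forall>i<m. c i \<in> carrier R" "\<forall>x\<in>carrier R. f x = (\<Oplus>i\<in>{..<m}. c i \<otimes> x [^] i)"
    using assms unfolding polyfun_def by auto
  define d where "d = (\<lambda>i. if i = 0 then \<zero> else c (i - 1))"
  have d: "\<forall>i<Suc m. d i \<in> carrier R"
    using c by (auto simp: d_def)
  have "x \<otimes> f x = (\<Oplus>i\<in>{..<Suc m}. d i \<otimes> x [^] i)" if x: "x \<in> carrier R" for x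
  proof -
    have "(\<Oplus>i\<in>{..<Suc m}. d i \<otimes> x [^] i) = d 0 \<otimes> x [^] (0::nat) \<oplus> (\<Oplus>i\<in>{..<m}. d (Suc i) \<otimes> x [^] Suc i)"
      using d x by (intro finsum_lessThan_Suc_shift) auto
    also have "\<dots> = (\<Oplus>i\<in>{..<m}. d (Suc i) \<otimes> x [^] Suc i)"
      using d x by (auto simp: d_def simp del: nat_pow_Suc intro!: l_zero finsum_closed)
    also have "\<dots> = (\<Oplus>i\<in>{..<m}. x \<otimes> (c i \<otimes> x [^] i))"
      using c x by (intro finsum_cong') (auto simp: d_def m_ac)
    also have "\<dots> = x \<otimes> f x"
      using c x by (subst finsum_rdistr[symmetric]) auto
    finally show ?thesis by simp
  qed
  then show ?thesis
    unfolding polyfun_def using d by (intro exI[of _ d]) auto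
qed

lemma polyfun_Suc:
  assumes "polyfun m f"
  shows "polyfun (Suc m) f"
proof -
  obtain c where c: "\<forall>i<m. c i \<in> carrier R" "\<forall>x\<in>carrier R. f x = (\<Oplus>i\<in>{..<m}. c i \<otimes> x [^] i)"
    using assms unfolding polyfun_def by auto
  have "f x = (\<Oplus>i\<in>{..<Suc m}. (if i = m then \<zero> else c i) \<otimes> x [^] i)" if x: "x \<in> carrier R" for x
  proof -
    have "(\<Oplus>i\<in>{..<m}. (if i = m then \<zero> else c i) \<otimes> x [^] i) = f x"
      using c x by (auto intro!: finsum_cong')
    then show ?thesis
      using c x by (subst finsum_lessThan_Suc) (auto intro!: finsum_closed)
  qed
  then show ?thesis
    unfolding polyfun_def using c by (intro exI[of _ "\<lambda>i. if i = m then \<zero> else c i"]) auto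
qed

lemma polyfun_mono: "polyfun m f \<Longrightarrow> m \<le> k \<Longrightarrow> polyfun k f"
  by (induction k) (auto simp: le_Suc_eq polyfun_Suc)

lemma polyfun_const: "a \<in> carrier R \<Longrightarrow> polyfun (Suc 0) (\<lambda>x. a)"
  unfolding polyfun_def by (intro exI[of _ "\<lambda>i. a"]) (auto simp: lessThan_Suc)

lemma polyfun_linear_mult:
  assumes "polyfun m f" "a \<in> carrier R"
  shows "polyfun (Suc m) (\<lambda>x. (x \<oplus> a) \<otimes> f x)"
  by (rule polyfun_cong[OF polyfun_add[OF polyfun_shift[OF assms(1)]
          polyfun_Suc[OF polyfun_smult[OF assms]]]])
    (use assms in \<open>auto simp: l_distr polyfun_closed\<close>)

lemma polyfun_linear_pow:
  assumes "a \<in> carrier R"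
  shows "polyfun (Suc k) (\<lambda>x. (x \<oplus> a) [^] k)"
proof (induction k)
  case 0
  then show ?case using polyfun_const[of \<one>] by simp
next
  case (Suc k)
  show ?case
    by (rule polyfun_cong[OF polyfun_linear_mult[OF Suc assms]]) (use assms in \<open>auto simp: m_comm\<close>)
qed

text \<open>The leading terms cancel, which saves one coefficient compared with
  \<open>polyfun_linear_pow\<close>; for exponent \<open>q\<close>, exactly \<open>q\<close> zeros
  then suffice. The induction uses (x+a)^(k+1) - x^(k+1) = (x+a)((x+a)^k - x^k) + a x^k.\<close>

lemma polyfun_linear_pow_minus_pow:
  assumes a: "a \<in> carrier R"
  shows "polyfun k (\<lambda>x. (x \<oplus> a) [^] k \<ominus> x [^] k)"
proof (induction k)
  case 0
  then show ?case by (auto simp: polyfun_def)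
next
  case (Suc k)
  have "polyfun (Suc k) (\<lambda>x. (x \<oplus> a) \<otimes> ((x \<oplus> a) [^] k \<ominus> x [^] k) \<oplus> a \<otimes> (x \<oplus> \<zero>) [^] k)"
    by (intro polyfun_add polyfun_linear_mult Suc polyfun_smult polyfun_linear_pow a) auto
  then show ?case
  proof (rule polyfun_cong)
    fix x assume x: "x \<in> carrier R"
    have c: "(x \<oplus> a) [^] k \<in> carrier R" "x [^] k \<in> carrier R"
      using x a by auto
    show "(x \<oplus> a) \<otimes> ((x \<oplus> a) [^] k \<ominus> x [^] k) \<oplus> a \<otimes> (x \<oplus> \<zero>) [^] k = (x \<oplus> a) [^] Suc k \<ominus> x [^] Suc k"
      using x a c unfolding nat_pow_Suc r_zero[OF x] by algebra
  qed
qed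

lemma polyfun_eval: "set p \<subseteq> carrier R \<Longrightarrow> polyfun (length p) (eval p)"
proof (induction p)
  case Nil
  then show ?case by (auto simp: polyfun_def)
next
  case (Cons a p)
  have "polyfun (Suc (length p)) (\<lambda>x. a \<otimes> (x \<oplus> \<zero>) [^] length p \<oplus> eval p x)"
    by (intro polyfun_add polyfun_smult polyfun_linear_pow polyfun_Suc Cons) (use Cons.prems in auto)
  then show ?case
    using Cons.prems by (auto elim!: polyfun_cong)
qed

end

text \<open>The alternative \<open>infinite A\<close> is separate because \<open>card\<close> is 0
  on infinite sets; a subset with \<open>m\<close> elements then serves.\<close>

lemma (in field) polyfun_zero_if_many_roots:
  assumes "polyfun m f" "A \<subseteq> carrier R" "m \<le> card A \<or> infinite A" "\<And>x. x \<in> A \<Longrightarrow> f x = \<zero>" "x \<in> carrier R"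
  shows "f x = \<zero>"
proof -
  obtain c where c: "\<forall>i<m. c i \<in> carrier R" "\<forall>x\<in>carrier R. f x = (\<Oplus>i\<in>{..<m}. c i \<otimes> x [^] i)"
    using assms unfolding polyfun_def by auto
  obtain B where B: "B \<subseteq> A" "m \<le> card B"
    using assms(3) infinite_arbitrarily_large[of A m] by blast
  have "c i = \<zero>" if "i < m" for i
  proof (rule coeffs_zero_if_many_roots[of m c B])
    show "(\<Oplus>i\<in>{..<m}. c i \<otimes> y [^] i) = \<zero>" if "y \<in> B" for y
      using that B(1) assms(2,4) c(2) by (metis subsetD)
  qed (use c B assms(2) that in auto)
  then have "(\<Oplus>i\<in>{..<m}. c i \<otimes> x [^] i) = \<zero>"
    using assms(5) by (intro add.finprod_one_eqI) auto
  then show ?thesis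
    using c assms(5) by simp
qed

section \<open>The fields of order \<open>q\<^sup>i\<close>\<close>

text \<open>Applied with \<open>e = \<zero>\<close>, where the roots are the elements of
  \<open>K i\<close>, and with \<open>e = \<one>\<close>, where a field with \<open>Q\<close>
  elements contains no root at all.\<close>

lemma (in field) poly_pow_minus_id:
  assumes "Q \<ge> 2" "e \<in> carrier R"
  obtains p where "p \<in> carrier (poly_ring R)" "degree p = Q"
    "\<And>x. x \<in> carrier R \<Longrightarrow> eval p x = x [^] Q \<ominus> x \<oplus> e"
proof
  let ?r = "[\<ominus> \<one>, e]"
  define p where "p = \<one> # replicate (Q - 2) \<zero> @ ?r"
  show "p \<in> carrier (poly_ring R)"
    unfolding p_def univ_poly_carrier[symmetric] using assms(2) by (auto simp: polynomial_def)
  show deg: "degree p = Q"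
    using assms(1) by (simp add: p_def)
  fix x assume x: "x \<in> carrier R"
  have "eval p x = x [^] Q \<oplus> eval (replicate (Q - 2) \<zero> @ ?r) x"
    using deg x unfolding p_def by simp
  also have "eval (replicate (Q - 2) \<zero> @ ?r) x = eval ?r x"
    by (intro eval_replicate) (use assms x in auto)
  also have "\<dots> = \<ominus> x \<oplus> e"
    using assms(2) x by (simp add: l_minus)
  finally show "eval p x = x [^] Q \<ominus> x \<oplus> e"
    using assms(2) x by (simp add: minus_eq a_assoc)
qed

text \<open>On a carrier with N elements, X^N - X + 1 would be constantly 1, yet it has positive
  degree and splits.\<close>

lemma (in algebraically_closed) infinite_carrier: "infinite (carrier L)"
proof
  assume fin: "finite (carrier L)"
  have two: "card (carrier L) \<ge> 2"
    using card_mono[OF fin, of "{\<zero>, \<one>}"] by simp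
  obtain p where p: "p \<in> carrier (poly_ring L)" "degree p = card (carrier L)"
    "\<And>x. x \<in> carrier L \<Longrightarrow> eval p x = x [^] card (carrier L) \<ominus> x \<oplus> \<one>"
    using poly_pow_minus_id[OF two one_closed] by blast
  have "size (roots p) = card (carrier L)"
    using roots_over_carrier[OF p(1)] p(2) unfolding splitted_def by simp
  then obtain x where "x \<in># roots p"
    using two by (metis multiset_nonemptyE size_empty not_numeral_le_zero)
  then have "x \<in> carrier L" "eval p x = \<zero>"
    by (auto simp: roots_mem_iff_is_root[OF p(1)] is_root_def)
  then show False
    using p(3)[of x] finite_field_pow_card[OF fin, of x] by (simp add: minus_eq r_neg)
qed

text \<open>\<open>L\<close> contains only a copy of \<open>F\<close>, with elements of another
  type; hence the embedding \<open>h\<close>.\<close>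

locale finite_field_ext = F: field F + field L
  for F :: "('f, 'g) ring_scheme" and L :: "('a, 'b) ring_scheme" (structure) +
  fixes h :: "'f \<Rightarrow> 'a" and q :: nat
  assumes h_hom: "h \<in> ring_hom F L"
    and fin_F: "finite (carrier F)"
    and q_def: "q = card (carrier F)"
begin

sublocale h: ring_hom_cring F L h
  by unfold_locales (rule h_hom)

lemma h_inj: "inj_on h (carrier F)"
proof (rule h.ring.non_trivial_field_hom_imp_inj[OF F.field_axioms])
  have "\<one> \<in> h ` carrier F"
    by (rule image_eqI[of _ _ "\<one>\<^bsub>F\<^esub>"]) auto
  then show "h ` carrier F \<noteq> {\<zero>}"
    using one_not_zero by (metis singletonD)
qed

lemma q_ge_2: "q \<ge> 2"
  unfolding q_def using card_mono[OF fin_F, of "{\<zero>\<^bsub>F\<^esub>, \<one>\<^bsub>F\<^esub>}"] F.one_not_zero by auto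

lemma pow_q_F: "c \<in> carrier F \<Longrightarrow> c [^]\<^bsub>F\<^esub> q = c"
  unfolding q_def by (rule F.finite_field_pow_card[OF fin_F])

lemma h_pow: "c \<in> carrier F \<Longrightarrow> h c [^] (k::nat) = h (c [^]\<^bsub>F\<^esub> k)"
  by (induction k) auto

lemma h_pow_q: "c \<in> carrier F \<Longrightarrow> h c [^] q = h c"
  by (simp add: h_pow pow_q_F)

text \<open>For fixed \<open>y\<close>, \<open>(x + y)\<^sup>q - x\<^sup>q - y\<^sup>q\<close> is a polynomial in \<open>x\<close> of degree less than \<open>q\<close> that vanishes
  at the \<open>q\<close> multiples of \<open>y\<close> by elements of \<open>F\<close>; so neither primes nor binomials are needed.\<close>
lemma frob_add:
  assumes x: "x \<in> carrier L" and y: "y \<in> carrier L"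
  shows "(x \<oplus> y) [^] q = x [^] q \<oplus> y [^] q"
proof (cases "y = \<zero>")
  case True
  then show ?thesis
    using x q_ge_2 by (simp add: nat_pow_zero)
next
  case False
  define f where "f = (\<lambda>x. ((x \<oplus> y) [^] q \<ominus> x [^] q) \<oplus> \<ominus> (y [^] q))"
  define A where "A = (\<lambda>c. h c \<otimes> y) ` carrier F"
  have "inj_on (\<lambda>c. h c \<otimes> y) (carrier F)"
  proof (rule inj_onI)
    fix c d assume cd: "c \<in> carrier F" "d \<in> carrier F" "h c \<otimes> y = h d \<otimes> y"
    then have "h c = h d"
      using m_rcancel[OF False y, of "h c" "h d"] by simp
    then show "c = d"
      using cd inj_onD[OF h_inj] by simp
  qed
  then have "card A = q"
    unfolding A_def q_def by (rule card_image)
  moreover have "polyfun q (\<lambda>x. \<ominus> (y [^] q))"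
    by (rule polyfun_mono[OF polyfun_const]) (use y q_ge_2 in auto)
  then have "polyfun q f"
    unfolding f_def by (intro polyfun_add polyfun_linear_pow_minus_pow y)
  moreover have "f z = \<zero>" if z: "z \<in> A" for z
  proof -
    obtain c where c: "c \<in> carrier F" "z = h c \<otimes> y"
      using z unfolding A_def by blast
    have "z \<oplus> y = h (c \<oplus>\<^bsub>F\<^esub> \<one>\<^bsub>F\<^esub>) \<otimes> y"
      using c y by (simp add: l_distr)
    then have "(z \<oplus> y) [^] q = (h c \<oplus> \<one>) \<otimes> y [^] q"
      using h_pow_q[of "c \<oplus>\<^bsub>F\<^esub> \<one>\<^bsub>F\<^esub>"] c y by (simp add: nat_pow_distrib)
    moreover have "z [^] q = h c \<otimes> y [^] q"
      using c y by (simp add: nat_pow_distrib h_pow_q)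
    moreover have "h c \<in> carrier L" "y [^] q \<in> carrier L"
      using c y by auto
    ultimately show ?thesis
      unfolding f_def by simp algebra
  qed
  moreover have "A \<subseteq> carrier L"
    using y by (auto simp: A_def)
  ultimately have "f x = \<zero>"
    using x by (intro polyfun_zero_if_many_roots[of q f A x]) auto
  moreover have c: "(x \<oplus> y) [^] q \<in> carrier L" "x [^] q \<in> carrier L" "y [^] q \<in> carrier L"
    using x y by auto
  have "(x \<oplus> y) [^] q = f x \<oplus> (x [^] q \<oplus> y [^] q)"
    unfolding f_def using c by algebra
  ultimately show ?thesis
    using c by simp
qed

lemma frob_pow_add:
  assumes x: "x \<in> carrier L" and y: "y \<in> carrier L"
  shows "(x \<oplus> y) [^] (q ^ k) = x [^] (q ^ k) \<oplus> y [^] (q ^ k)"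
proof (induction k)
  case (Suc k)
  have "z [^] (q ^ Suc k) = (z [^] (q ^ k)) [^] q" if "z \<in> carrier L" for z
    using that by (simp add: nat_pow_pow mult.commute)
  then show ?case
    using Suc x y by (simp add: frob_add)
qed (use x y in simp)

lemma frob_finsum:
  assumes "finite A" "\<And>i. i \<in> A \<Longrightarrow> f i \<in> carrier L"
  shows "(\<Oplus>i\<in>A. f i) [^] q = (\<Oplus>i\<in>A. f i [^] q)"
  using assms
proof (induction A rule: finite_induct)
  case empty
  then show ?case using q_ge_2 by (simp add: nat_pow_zero)
next
  case (insert a A)
  then show ?case
    by (subst (1 2) finsum_insert) (auto simp: frob_add intro!: finsum_closed)
qed

text \<open>The fixed points of the i-th iterate of Frobenius: for \<open>L\<close> algebraically
  closed and \<open>i \<ge> 1\<close>, the subfield of order \<open>q ^ i\<close>.\<close>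

definition K :: "nat \<Rightarrow> 'a set" where
  "K i = {x \<in> carrier L. x [^] (q ^ i) = x}"

end

text \<open>\<open>K i\<close> is the root set of X^Q - X with Q = q^i, which splits over
  \<open>L\<close>; what needs an argument is that the roots are simple. Additivity of the Q-th
  power map takes the place of a formal derivative.\<close>

lemma (in finite_field_ext) card_K:
  assumes "algebraically_closed L" "i \<ge> 1"
  shows "card (K i) = q ^ i"
proof -
  interpret algebraically_closed L by fact
  define Q where "Q = q ^ i"
  have Q: "Q \<ge> 2"
    using assms(2) q_ge_2 unfolding Q_def
    by (metis le_trans power_increasing power_one_right one_le_numeral)
  obtain p where p: "p \<in> carrier (poly_ring L)" "degree p = Q"
    "\<And>x. x \<in> carrier L \<Longrightarrow> eval p x = x [^] Q \<ominus> x \<oplus> \<zero>"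
    using poly_pow_minus_id[OF Q zero_closed] by blast
  have ne: "p \<noteq> []"
    using p(2) Q by auto
  have size: "size (roots p) = Q"
    using roots_over_carrier[OF p(1)] p(2) unfolding splitted_def by simp
  have mult: "count (roots p) b \<le> 1" if b: "b \<in># roots p" for b
  proof (rule ccontr)
    assume "\<not> count (roots p) b \<le> 1"
    then have "2 \<le> alg_mult p b"
      by (simp add: alg_mult_eq_count_roots[OF p(1)])
    have bL: "b \<in> carrier L" and b0: "eval p b = \<zero>"
      using b by (auto simp: roots_mem_iff_is_root[OF p(1)] is_root_def)
    let ?l = "[\<one>, \<ominus> b]"
    interpret P: domain "poly_ring L"
      using univ_poly_is_domain[OF carrier_is_subring] .
    have l: "?l \<in> carrier (poly_ring L)"
      unfolding univ_poly_carrier[symmetric] using bL by (auto simp: polynomial_def)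
    have "(?l [^]\<^bsub>poly_ring L\<^esub> (2::nat)) pdivides p"
      by (rule le_alg_mult_imp_pdivides[OF bL p(1) \<open>2 \<le> alg_mult p b\<close>])
    then obtain r where r: "r \<in> carrier (poly_ring L)"
      "p = (?l [^]\<^bsub>poly_ring L\<^esub> (2::nat)) \<otimes>\<^bsub>poly_ring L\<^esub> r"
      unfolding pdivides_def by (auto elim!: dividesE)
    have rc: "set r \<subseteq> carrier L"
      using r(1) unfolding univ_poly_carrier[symmetric] by (auto simp: polynomial_def)
    have bp: "b [^] Q = b"
      using b0 p(3)[OF bL] bL by (simp add: r_right_minus_eq)
    have factor: "x [^] Q \<ominus> x = (x \<ominus> b) \<otimes> ((x \<ominus> b) \<otimes> eval r x)" if x: "x \<in> carrier L" for x
    proof -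
      interpret ev: ring_hom_cring "poly_ring L" L "\<lambda>p. eval p x"
        by (intro ring_hom_cring.intro ring_hom_cring_axioms.intro P.is_cring is_cring
            eval_is_hom[OF carrier_is_subring x])
      have "eval ?l x = x \<ominus> b"
        using x bL by (simp add: minus_eq)
      moreover have "eval r x \<in> carrier L"
        using r(1) by auto
      ultimately have "eval p x = (x \<ominus> b) \<otimes> ((x \<ominus> b) \<otimes> eval r x)"
        using r l x bL by (simp add: numeral_2_eq_2 m_assoc)
      then show ?thesis
        using p(3)[OF x] x by simp
    qed
    txt \<open>\<open>X\<^sup>Q - X = (X - b)\<^sup>Q - (X - b)\<close>, so a second factor \<open>X - b\<close> would divide \<open>(X - b)\<^bsup>Q-1\<^esup> - 1\<close>.\<close>
    define f where "f = (\<lambda>x. (x \<oplus> \<ominus> b) [^] (Q - 1) \<oplus> (\<ominus> \<one> \<oplus> \<ominus> \<one> \<otimes> ((x \<oplus> \<ominus> b) \<otimes> eval r x)))"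
    define m where "m = Suc (Q + length r)"
    have pf: "polyfun m f"
      unfolding f_def
      by (intro polyfun_add; rule polyfun_mono[OF polyfun_linear_pow] polyfun_mono[OF polyfun_const]
           polyfun_mono[OF polyfun_smult[OF polyfun_linear_mult[OF polyfun_eval]]])
        (use bL rc in \<open>auto simp: m_def\<close>)
    have f0: "f x = \<zero>" if "x \<in> carrier L - {b}" for x
    proof -
      have x: "x \<in> carrier L" "x \<ominus> b \<noteq> \<zero>"
        using that bL by (auto simp: r_right_minus_eq)
      have er: "eval r x \<in> carrier L"
        using rc x eval_in_carrier by auto
      define u where "u = x \<ominus> b"
      define v where "v = u [^] (Q - 1)"
      define e where "e = eval r x"
      have c: "u \<in> carrier L" "v \<in> carrier L" "e \<in> carrier L"
        using x bL er by (auto simp: u_def v_def e_def)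
      have xu: "x = u \<oplus> b"
        using x bL by (simp add: u_def minus_eq a_assoc l_neg)
      have "u [^] Q = u \<otimes> v"
        using Q c(1) unfolding v_def by (metis Suc_diff_1 nat_pow_Suc2 pos2 less_le_trans)
      then have "x [^] Q = u \<otimes> v \<oplus> b"
        using frob_pow_add[OF c(1) bL, of i] bp unfolding xu Q_def by simp
      then have "u \<otimes> v \<oplus> b \<ominus> (u \<oplus> b) = u \<otimes> (u \<otimes> e)"
        using factor[OF x(1)] xu unfolding u_def[symmetric] e_def[symmetric] by simp
      moreover have "u \<otimes> (v \<oplus> (\<ominus> \<one> \<oplus> \<ominus> \<one> \<otimes> (u \<otimes> e))) = u \<otimes> v \<ominus> u \<ominus> u \<otimes> (u \<otimes> e)"
        using c by algebra
      moreover have "u \<otimes> v \<ominus> u \<ominus> (u \<otimes> v \<oplus> b \<ominus> (u \<oplus> b)) = \<zero>"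
        using c bL by algebra
      ultimately have "(x \<ominus> b) \<otimes> f x = \<zero>"
        unfolding f_def minus_eq[symmetric] u_def[symmetric] v_def[symmetric] e_def[symmetric] by simp
      moreover have "f x \<in> carrier L"
        using pf x polyfun_closed by auto
      ultimately show ?thesis
        using x bL by (meson integral minus_closed)
    qed
    \<comment> \<open>\<open>f\<close> vanishes off \<open>b\<close>, and infinitely many zeros
      force a zero at \<open>b\<close> as well. But its value there is -1, because
      \<open>Q - 1 \<ge> 1\<close> kills the power.\<close>
    have "f b = \<zero>"
      by (rule polyfun_zero_if_many_roots[where A = "carrier L - {b}", OF pf _ _ f0 bL]) (use infinite_carrier in auto)
    moreover have "f b = \<ominus> \<one>"
      using Q bL rc eval_in_carrier[OF rc bL] by (simp add: f_def r_neg nat_pow_zero)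
    ultimately show False
      by (metis minus_minus minus_zero one_closed one_not_zero)
  qed
  have "K i = set_mset (roots p)"
    using p(3) ne by (auto simp: K_def Q_def[symmetric] roots_mem_iff_is_root[OF p(1)] is_root_def r_right_minus_eq)
  moreover have "card (set_mset (roots p)) = size (roots p)"
    unfolding size_multiset_overloaded_eq card_eq_sum
  proof (rule sum.cong)
    fix b assume "b \<in># roots p"
    then show "1 = count (roots p) b"
      using mult[of b] by (simp add: le_antisym Suc_le_eq)
  qed simp
  ultimately show ?thesis
    using size Q_def by simp
qed

section \<open>Matrices with prescribed eigenvalues\<close>

lemma (in abelian_monoid) finsum_swap:
  assumes "finite A" "finite B" "\<And>i j. i \<in> A \<Longrightarrow> j \<in> B \<Longrightarrow> f i j \<in> carrier G"
  shows "(\<Oplus>i\<in>A. \<Oplus>j\<in>B. f i j) = (\<Oplus>j\<in>B. \<Oplus>i\<in>A. f i j)"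
  using assms(1,3)
proof (induction A rule: finite_induct)
  case empty
  then show ?case by (simp add: finsum_zero)
next
  case (insert a A)
  have "(\<Oplus>j\<in>B. \<Oplus>i\<in>insert a A. f i j) = (\<Oplus>j\<in>B. f a j \<oplus> (\<Oplus>i\<in>A. f i j))"
    using insert by (intro finsum_cong' finsum_insert) (auto intro!: finsum_closed)
  also have "\<dots> = (\<Oplus>j\<in>B. f a j) \<oplus> (\<Oplus>j\<in>B. \<Oplus>i\<in>A. f i j)"
    using insert by (intro finsum_addf) (auto intro!: finsum_closed)
  finally show ?case
    using insert by (subst finsum_insert) (auto intro!: finsum_closed)
qed

locale GL_ext = finite_field_ext F L h q
  for F :: "('f, 'g) ring_scheme" and L :: "('a, 'b) ring_scheme" (structure) and h q +
  fixes n :: nat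
  assumes n_pos: "n \<ge> 1"
begin

abbreviation "Mat \<equiv> mat_monoid F n"

text \<open>The matrix is over \<open>F\<close> but acts on columns over \<open>L\<close>.
  Coordinates from \<open>n\<close> on are set to zero, so that equal vectors are equal
  functions.\<close>

definition act :: "'f mat \<Rightarrow> (nat \<Rightarrow> 'a) \<Rightarrow> nat \<Rightarrow> 'a" where
  "act A u = (\<lambda>r. if r < n then \<Oplus>s\<in>{..<n}. h (A $$ (r, s)) \<otimes> u s else \<zero>)"

definition Vec :: "(nat \<Rightarrow> 'a) set" where
  "Vec = {u. (\<forall>r<n. u r \<in> carrier L) \<and> (\<forall>r\<ge>n. u r = \<zero>)}"

text \<open>The Vandermonde column of \<open>b\<close>: applying \<open>A\<close> to it evaluates
  the rows of \<open>A\<close>, read as polynomials, at \<open>b\<close>.\<close>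

definition vand :: "'a \<Rightarrow> nat \<Rightarrow> 'a" where
  "vand b = (\<lambda>r. if r < n then b [^] r else \<zero>)"

definition smul :: "'a \<Rightarrow> (nat \<Rightarrow> 'a) \<Rightarrow> nat \<Rightarrow> 'a" where
  "smul k u = (\<lambda>r. k \<otimes> u r)"

lemma Vec_closed: "u \<in> Vec \<Longrightarrow> u r \<in> carrier L"
  unfolding Vec_def by (cases "r < n") auto

lemma vand_Vec: "b \<in> carrier L \<Longrightarrow> vand b \<in> Vec"
  by (auto simp: vand_def Vec_def)

lemma vand_0: "vand b 0 = \<one>"
  using n_pos by (simp add: vand_def)

lemma Mat_entry: "A \<in> carrier Mat \<Longrightarrow> i < n \<Longrightarrow> j < n \<Longrightarrow> A $$ (i, j) \<in> carrier F"
  by (simp add: mat_monoid_def)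

lemma h_entry: "A \<in> carrier Mat \<Longrightarrow> i < n \<Longrightarrow> j < n \<Longrightarrow> h (A $$ (i, j)) \<in> carrier L"
  by (simp add: Mat_entry)

lemma act_Vec: "A \<in> carrier Mat \<Longrightarrow> u \<in> Vec \<Longrightarrow> act A u \<in> Vec"
  unfolding act_def by (auto simp: Vec_def intro!: finsum_closed h_entry)

lemma act_one: "u \<in> Vec \<Longrightarrow> act \<one>\<^bsub>Mat\<^esub> u = u"
proof
  fix r assume u: "u \<in> Vec"
  show "act \<one>\<^bsub>Mat\<^esub> u r = u r"
  proof (cases "r < n")
    case True
    have "(\<Oplus>s\<in>{..<n}. h (\<one>\<^bsub>Mat\<^esub> $$ (r, s)) \<otimes> u s) = (\<Oplus>s\<in>{..<n}. if r = s then u s else \<zero>)"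
      using u True by (intro finsum_cong') (auto simp: mat_monoid_def Vec_closed)
    also have "\<dots> = u r"
      using u True by (intro finsum_singleton) (auto simp: Vec_closed)
    finally show ?thesis
      using True by (simp add: act_def)
  qed (use u in \<open>simp add: act_def Vec_def\<close>)
qed

lemma act_mult:
  assumes A: "A \<in> carrier Mat" and B: "B \<in> carrier Mat" and u: "u \<in> Vec"
  shows "act (A \<otimes>\<^bsub>Mat\<^esub> B) u = act A (act B u)"
proof
  fix r
  show "act (A \<otimes>\<^bsub>Mat\<^esub> B) u r = act A (act B u) r"
  proof (cases "r < n")
    case r: True
    note cl = h_entry[OF A] h_entry[OF B] Mat_entry[OF A] Mat_entry[OF B] Vec_closed[OF u]
    have "h ((A \<otimes>\<^bsub>Mat\<^esub> B) $$ (r, s)) \<otimes> u s =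
          (\<Oplus>k\<in>{..<n}. h (A $$ (r, k)) \<otimes> (h (B $$ (k, s)) \<otimes> u s))" if s: "s < n" for s
    proof -
      have "h ((A \<otimes>\<^bsub>Mat\<^esub> B) $$ (r, s)) = h (\<Oplus>\<^bsub>F\<^esub>k\<in>{..<n}. A $$ (r, k) \<otimes>\<^bsub>F\<^esub> B $$ (k, s))"
        using r s by (simp add: mat_monoid_def)
      also have "\<dots> = (\<Oplus>k\<in>{..<n}. h (A $$ (r, k) \<otimes>\<^bsub>F\<^esub> B $$ (k, s)))"
        using r s cl by (subst h.hom_finsum) (auto simp: comp_def)
      also have "\<dots> = (\<Oplus>k\<in>{..<n}. h (A $$ (r, k)) \<otimes> h (B $$ (k, s)))"
        using r s cl by (intro finsum_cong') auto
      finally have "h ((A \<otimes>\<^bsub>Mat\<^esub> B) $$ (r, s)) \<otimes> u s =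
          (\<Oplus>k\<in>{..<n}. (h (A $$ (r, k)) \<otimes> h (B $$ (k, s))) \<otimes> u s)"
        using r s cl by (subst finsum_ldistr[symmetric]) auto
      also have "\<dots> = (\<Oplus>k\<in>{..<n}. h (A $$ (r, k)) \<otimes> (h (B $$ (k, s)) \<otimes> u s))"
        using r s cl by (intro finsum_cong') (auto simp: m_assoc)
      finally show ?thesis .
    qed
    then have "act (A \<otimes>\<^bsub>Mat\<^esub> B) u r = (\<Oplus>s\<in>{..<n}. \<Oplus>k\<in>{..<n}. h (A $$ (r, k)) \<otimes> (h (B $$ (k, s)) \<otimes> u s))"
      using r cl unfolding act_def by (auto intro!: finsum_cong' finsum_closed)
    also have "\<dots> = (\<Oplus>k\<in>{..<n}. \<Oplus>s\<in>{..<n}. h (A $$ (r, k)) \<otimes> (h (B $$ (k, s)) \<otimes> u s))"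
      using r cl by (intro finsum_swap) auto
    also have "\<dots> = (\<Oplus>k\<in>{..<n}. h (A $$ (r, k)) \<otimes> (\<Oplus>s\<in>{..<n}. h (B $$ (k, s)) \<otimes> u s))"
      using r cl by (intro finsum_cong' finsum_rdistr[symmetric]) (auto intro!: finsum_closed)
    also have "\<dots> = act A (act B u) r"
      using r cl unfolding act_def by (auto intro!: finsum_cong' finsum_closed)
    finally show ?thesis .
  qed (simp add: act_def)
qed

lemma act_smul:
  assumes A: "A \<in> carrier Mat" and u: "u \<in> Vec" and k: "k \<in> carrier L"
  shows "act A (smul k u) = smul k (act A u)"
proof
  fix r
  note cl = h_entry[OF A] Vec_closed[OF u] k
  have "(\<Oplus>s\<in>{..<n}. h (A $$ (r, s)) \<otimes> (k \<otimes> u s)) = k \<otimes> (\<Oplus>s\<in>{..<n}. h (A $$ (r, s)) \<otimes> u s)"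
    if "r < n"
  proof -
    have "(\<Oplus>s\<in>{..<n}. h (A $$ (r, s)) \<otimes> (k \<otimes> u s)) = (\<Oplus>s\<in>{..<n}. k \<otimes> (h (A $$ (r, s)) \<otimes> u s))"
      using cl that by (intro finsum_cong') (auto simp: m_lcomm)
    then show ?thesis
      using cl that by (subst (asm) finsum_rdistr[symmetric]) auto
  qed
  then show "act A (smul k u) r = smul k (act A u) r"
    using k by (simp add: act_def smul_def)
qed

section \<open>Frobenius compatibility and interpolation over \<open>F\<close>\<close>

lemma h_frob_sum:
  assumes "\<And>s. s < n \<Longrightarrow> a s \<in> carrier F" "b \<in> carrier L"
  shows "(\<Oplus>s\<in>{..<n}. h (a s) \<otimes> b [^] s) [^] q = (\<Oplus>s\<in>{..<n}. h (a s) \<otimes> (b [^] q) [^] s)"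
proof -
  have "(\<Oplus>s\<in>{..<n}. h (a s) \<otimes> b [^] s) [^] q = (\<Oplus>s\<in>{..<n}. (h (a s) \<otimes> b [^] s) [^] q)"
    using assms by (intro frob_finsum) auto
  also have "\<dots> = (\<Oplus>s\<in>{..<n}. h (a s) \<otimes> (b [^] q) [^] s)"
    using assms by (intro finsum_cong') (auto simp: nat_pow_distrib h_pow_q nat_pow_pow mult.commute)
  finally show ?thesis .
qed

lemma act_vand:
  assumes "A \<in> carrier Mat" "b \<in> carrier L" "r < n"
  shows "act A (vand b) r = (\<Oplus>s\<in>{..<n}. h (A $$ (r, s)) \<otimes> b [^] s)"
  using assms h_entry[OF assms(1)] by (auto simp: act_def vand_def intro!: finsum_cong')

lemma act_vand_frob:
  assumes "A \<in> carrier Mat" "b \<in> carrier L" "r < n"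
  shows "act A (vand b) r [^] q = act A (vand (b [^] q)) r"
  using assms h_frob_sum[of "\<lambda>s. A $$ (r, s)" b] Mat_entry[OF assms(1)] by (simp add: act_vand)

text \<open>For a \<open>frob_set\<close> these functions are exactly the values on \<open>S\<close>
  of the polynomials over \<open>F\<close> of degree less than \<open>n\<close>; that is, they form
  the algebra F[X] modulo the product of the X - b.\<close>

definition equivariant :: "'a set \<Rightarrow> ('a \<Rightarrow> 'a) set" where
  "equivariant S = {c \<in> S \<rightarrow>\<^sub>E carrier L. \<forall>b\<in>S. c (b [^] q) = c b [^] q}"

text \<open>The bound on the number of equivariant functions holds for all Frobenius-stable sets of size \<open>n\<close>.  It is
  part of the definition because it is immediate for the sets of conjugates considered below.\<close>
definition frob_set :: "'a set \<Rightarrow> bool" where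
  "frob_set S \<longleftrightarrow> S \<subseteq> carrier L - {\<zero>} \<and> card S = n \<and> (\<forall>b\<in>S. b [^] q \<in> S) \<and>
     finite (equivariant S) \<and> card (equivariant S) \<le> q ^ n"

lemma frob_set_closed: "frob_set S \<Longrightarrow> b \<in> S \<Longrightarrow> b \<in> carrier L"
  by (auto simp: frob_set_def)

text \<open>Invertibility of the Vandermonde matrix at the \<open>n\<close> points of
  \<open>S\<close>: the polynomial of coefficient differences has \<open>n\<close> roots but only
  \<open>n\<close> coefficients.\<close>

lemma coeffs_eqI:
  assumes S: "frob_set S" and c: "\<And>s. s < n \<Longrightarrow> c s \<in> carrier L" and d: "\<And>s. s < n \<Longrightarrow> d s \<in> carrier L"
    and eq: "\<And>b. b \<in> S \<Longrightarrow> (\<Oplus>s\<in>{..<n}. c s \<otimes> b [^] s) = (\<Oplus>s\<in>{..<n}. d s \<otimes> b [^] s)"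
    and s: "s < n"
  shows "c s = d s"
proof -
  have "c s \<ominus> d s = \<zero>"
  proof (rule coeffs_zero_if_many_roots[where A = S and d = n])
    fix b assume b: "b \<in> S"
    have bL: "b \<in> carrier L"
      using frob_set_closed[OF S b] .
    have "(\<Oplus>s\<in>{..<n}. (c s \<ominus> d s) \<otimes> b [^] s \<oplus> d s \<otimes> b [^] s) = (\<Oplus>s\<in>{..<n}. c s \<otimes> b [^] s)"
      using c d bL by (intro finsum_cong') (auto simp: l_distr[symmetric] minus_eq a_assoc l_neg)
    moreover have "(\<Oplus>s\<in>{..<n}. (c s \<ominus> d s) \<otimes> b [^] s \<oplus> d s \<otimes> b [^] s) =
      (\<Oplus>s\<in>{..<n}. (c s \<ominus> d s) \<otimes> b [^] s) \<oplus> (\<Oplus>s\<in>{..<n}. d s \<otimes> b [^] s)"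
      using c d bL by (intro finsum_addf) auto
    moreover have cl: "(\<Oplus>s\<in>{..<n}. (c s \<ominus> d s) \<otimes> b [^] s) \<in> carrier L"
      "(\<Oplus>s\<in>{..<n}. d s \<otimes> b [^] s) \<in> carrier L"
      using c d bL by (auto intro!: finsum_closed)
    ultimately have "(\<Oplus>s\<in>{..<n}. (c s \<ominus> d s) \<otimes> b [^] s) \<oplus> (\<Oplus>s\<in>{..<n}. d s \<otimes> b [^] s) =
        \<zero> \<oplus> (\<Oplus>s\<in>{..<n}. d s \<otimes> b [^] s)"
      using eq[OF b] by simp
    then show "(\<Oplus>s\<in>{..<n}. (c s \<ominus> d s) \<otimes> b [^] s) = \<zero>"
      using add.right_cancel[OF cl(2) cl(1) zero_closed] by blast
  qed (use S c d s in \<open>auto simp: frob_set_def\<close>)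
  then show ?thesis
    using c d s by (simp add: r_right_minus_eq)
qed

text \<open>The polynomials over \<open>F\<close> of degree less than \<open>n\<close> inject into the equivariant functions, of which there
  are not more.\<close>
lemma interpolation:
  assumes S: "frob_set S" and c: "c \<in> equivariant S"
  obtains a where "\<And>s. s < n \<Longrightarrow> a s \<in> carrier F"
    "\<And>b. b \<in> S \<Longrightarrow> (\<Oplus>s\<in>{..<n}. h (a s) \<otimes> b [^] s) = c b"
proof -
  let ?X = "{..<n} \<rightarrow>\<^sub>E carrier F"
  define \<phi> where "\<phi> = (\<lambda>a. \<lambda>b\<in>S. \<Oplus>s\<in>{..<n}. h (a s) \<otimes> b [^] s)"
  have "\<phi> ` ?X \<subseteq> equivariant S"
  proof (rule image_subsetI)
    fix a assume a: "a \<in> ?X"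
    then have ac: "a s \<in> carrier F" if "s < n" for s
      using that by auto
    have "(\<Oplus>s\<in>{..<n}. h (a s) \<otimes> b [^] s) \<in> carrier L" if "b \<in> S" for b
      using ac frob_set_closed[OF S that] by (intro finsum_closed) auto
    moreover have "(\<Oplus>s\<in>{..<n}. h (a s) \<otimes> b [^] s) [^] q = (\<Oplus>s\<in>{..<n}. h (a s) \<otimes> (b [^] q) [^] s)"
      if "b \<in> S" for b
      using h_frob_sum[of a b] ac frob_set_closed[OF S that] by blast
    moreover have "b [^] q \<in> S" if "b \<in> S" for b
      using S that by (simp add: frob_set_def)
    ultimately show "\<phi> a \<in> equivariant S"
      unfolding equivariant_def \<phi>_def by simp
  qed
  moreover have "inj_on \<phi> ?X"
  proof (rule inj_onI)
    fix a d assume a: "a \<in> ?X" and d: "d \<in> ?X" and eq: "\<phi> a = \<phi> d"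
    have "h (a s) = h (d s)" if "s < n" for s
    proof (rule coeffs_eqI[OF S _ _ _ that])
      fix b assume "b \<in> S"
      then show "(\<Oplus>s\<in>{..<n}. h (a s) \<otimes> b [^] s) = (\<Oplus>s\<in>{..<n}. h (d s) \<otimes> b [^] s)"
        using fun_cong[OF eq, of b] by (simp add: \<phi>_def)
    qed (use a d in auto)
    then have "a s = d s" if "s < n" for s
      using that a d by (intro inj_onD[OF h_inj]) auto
    then show "a = d"
      using a d by (intro PiE_ext[of a "{..<n}" "\<lambda>_. carrier F" d]) auto
  qed
  then have "card (\<phi> ` ?X) = q ^ n"
    by (simp add: card_image card_PiE q_def)
  ultimately have "\<phi> ` ?X = equivariant S"
    using S by (intro card_seteq) (auto simp: frob_set_def)
  then obtain a where a: "a \<in> ?X" "c = \<phi> a"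
    using c by blast
  show thesis
    by (rule that[of a]) (use a in \<open>auto simp: \<phi>_def\<close>)
qed

text \<open>Each row is a polynomial of degree less than \<open>n\<close>, pinned down by its values
  at the \<open>n\<close> points of \<open>S\<close>.\<close>

lemma mat_eqI:
  assumes S: "frob_set S" and A: "A \<in> carrier Mat" and B: "B \<in> carrier Mat"
    and eq: "\<And>b. b \<in> S \<Longrightarrow> act A (vand b) = act B (vand b)"
  shows "A = B"
proof (rule eq_matI)
  fix i j assume "i < dim_row B" "j < dim_col B"
  then have ij: "i < n" "j < n"
    using B by (auto simp: mat_monoid_def)
  have "h (A $$ (i, j)) = h (B $$ (i, j))"
    by (rule coeffs_eqI[OF S _ _ _ ij(2), where c = "\<lambda>j. h (A $$ (i, j))" and d = "\<lambda>j. h (B $$ (i, j))"])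
      (use ij A B h_entry eq frob_set_closed[OF S] in \<open>auto simp flip: act_vand\<close>)
  then show "A $$ (i, j) = B $$ (i, j)"
    using ij by (intro inj_onD[OF h_inj]) (auto intro!: Mat_entry A B)
qed (use A B in \<open>auto simp: mat_monoid_def\<close>)

text \<open>Multiplication by \<open>c\<close> in the algebra of equivariant functions, written as a
  matrix. For a \<open>frob_set\<close> the choice is unambiguous by \<open>mat_eqI\<close>.\<close>

definition multiplier :: "'a set \<Rightarrow> ('a \<Rightarrow> 'a) \<Rightarrow> 'f mat" where
  "multiplier S c = (SOME A. A \<in> carrier Mat \<and> (\<forall>b\<in>S. act A (vand b) = smul (c b) (vand b)))"

text \<open>Row \<open>r\<close> has to be a polynomial over \<open>F\<close> with value
  \<open>c b \<otimes> b [^] r\<close> at every \<open>b\<close> in \<open>S\<close>. As a function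
  of \<open>b\<close> this is equivariant again, so it can be interpolated.\<close>

lemma multiplier:
  assumes S: "frob_set S" and c: "c \<in> equivariant S"
  shows "multiplier S c \<in> carrier Mat" "b \<in> S \<Longrightarrow> act (multiplier S c) (vand b) = smul (c b) (vand b)"
proof -
  have cL: "c b \<in> carrier L" if "b \<in> S" for b
    using c that by (auto simp: equivariant_def)
  have "\<exists>a. (\<forall>s<n. a s \<in> carrier F) \<and> (\<forall>b\<in>S. (\<Oplus>s\<in>{..<n}. h (a s) \<otimes> b [^] s) = c b \<otimes> b [^] r)" for r :: nat
  proof -
    have "(\<lambda>b\<in>S. c b \<otimes> b [^] r) \<in> equivariant S"
      using c cL S frob_set_closed[OF S] unfolding equivariant_def
      by (auto simp: frob_set_def nat_pow_distrib nat_pow_pow mult.commute)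
    from interpolation[OF S this] obtain a where a: "\<And>s. s < n \<Longrightarrow> a s \<in> carrier F"
      "\<And>b. b \<in> S \<Longrightarrow> (\<Oplus>s\<in>{..<n}. h (a s) \<otimes> b [^] s) = (\<lambda>b\<in>S. c b \<otimes> b [^] r) b"
      by blast
    then show ?thesis
      by (intro exI[of _ a]) simp
  qed
  then obtain a where a: "\<And>r s. s < n \<Longrightarrow> a r s \<in> carrier F"
    "\<And>r b. b \<in> S \<Longrightarrow> (\<Oplus>s\<in>{..<n}. h (a r s) \<otimes> b [^] s) = c b \<otimes> b [^] (r::nat)"
    by metis
  define A where "A = mat n n (\<lambda>(r, s). a r s)"
  have A: "A \<in> carrier Mat"
    using a(1) by (auto simp: A_def mat_monoid_def)
  have "act A (vand b) = smul (c b) (vand b)" if b: "b \<in> S" for b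
  proof
    fix r
    show "act A (vand b) r = smul (c b) (vand b) r"
    proof (cases "r < n")
      case True
      have "act A (vand b) r = (\<Oplus>s\<in>{..<n}. h (a r s) \<otimes> b [^] s)"
        using True a(1) b frob_set_closed[OF S b] by (auto simp: act_def vand_def A_def intro!: finsum_cong')
      then show ?thesis
        using a(2)[OF b] True by (simp add: smul_def vand_def)
    qed (use cL[OF b] in \<open>simp add: act_def smul_def vand_def\<close>)
  qed
  with A have "\<exists>A. A \<in> carrier Mat \<and> (\<forall>b\<in>S. act A (vand b) = smul (c b) (vand b))"
    by blast
  from someI_ex[OF this] show "multiplier S c \<in> carrier Mat" "b \<in> S \<Longrightarrow> act (multiplier S c) (vand b) = smul (c b) (vand b)"
    unfolding multiplier_def by blast+
qed

end

section \<open>Conjugacy classes and powers\<close>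

lemma card_le_card_image_mult:
  assumes "finite A" "\<And>y. y \<in> f ` A \<Longrightarrow> card {x \<in> A. f x = y} \<le> k"
  shows "card A \<le> card (f ` A) * k"
proof -
  have "card A = (\<Sum>y\<in>f ` A. card {x \<in> A. f x = y})"
    using sum.image_gen[of A "\<lambda>_. 1 :: nat" f] assms(1) by simp
  also have "\<dots> \<le> card (f ` A) * k"
    using sum_bounded_above[of "f ` A" "\<lambda>y. card {x \<in> A. f x = y}" k] assms(2) by simp
  finally show ?thesis .
qed

lemma (in field) inv_nat_pow:
  assumes "x \<in> carrier R" "x \<noteq> \<zero>"
  shows "inv (x [^] (k::nat)) = (inv x) [^] k"
proof -
  have u: "x \<in> Units R"
    using assms by (simp add: field_Units)
  have "x [^] k \<otimes> (inv x) [^] k = (x \<otimes> inv x) [^] k"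
    using u by (subst nat_pow_distrib) (auto simp: Units_closed)
  then have "x [^] k \<otimes> (inv x) [^] k = \<one>"
    using u by simp
  then show ?thesis
    using u by (intro comm_inv_char) (auto simp: Units_closed)
qed

context GL_ext
begin

abbreviation "G \<equiv> GL n F"

sublocale G: group G
  by (rule group_GL) (rule F.ring_axioms)

lemma G_carrier: "carrier G = Units Mat"
  by (simp add: GL_def units_of_carrier)

lemma G_Mat: "g \<in> carrier G \<Longrightarrow> g \<in> carrier Mat"
  by (auto simp: G_carrier Units_def)

lemma G_mult: "g \<otimes>\<^bsub>G\<^esub> k = g \<otimes>\<^bsub>Mat\<^esub> k"
  by (simp add: GL_def units_of_mult)

lemma G_one: "\<one>\<^bsub>G\<^esub> = \<one>\<^bsub>Mat\<^esub>"
  by (simp add: GL_def units_of_one)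

lemma finite_G: "finite (carrier G)"
  by (rule finite_GL[OF fin_F])

lemma act_G_mult: "g \<in> carrier G \<Longrightarrow> k \<in> carrier G \<Longrightarrow> u \<in> Vec \<Longrightarrow> act (g \<otimes>\<^bsub>G\<^esub> k) u = act g (act k u)"
  by (simp add: G_mult act_mult G_Mat)

lemma act_G_one: "u \<in> Vec \<Longrightarrow> act \<one>\<^bsub>G\<^esub> u = u"
  by (simp add: G_one act_one)

lemma act_zero_imp_zero:
  assumes g: "g \<in> carrier G" and u: "u \<in> Vec" and "act g u = (\<lambda>_. \<zero>)"
  shows "u = (\<lambda>_. \<zero>)"
proof -
  have i: "inv\<^bsub>G\<^esub> g \<in> carrier G"
    using g by simp
  have "u = act (inv\<^bsub>G\<^esub> g) (act g u)"
    using g u i by (simp add: act_G_mult[symmetric] G.l_inv act_G_one del: G.inv_closed)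
  also have "\<dots> = act (inv\<^bsub>G\<^esub> g) (\<lambda>_. \<zero>)"
    using assms by simp
  also have "\<dots> = (\<lambda>_. \<zero>)"
    using h_entry[OF G_Mat[OF i]] by (auto simp: act_def fun_eq_iff intro!: add.finprod_one_eqI)
  finally show ?thesis .
qed

section \<open>Matrices that are diagonal in the Vandermonde columns\<close>

lemma equivariant_closed: "c \<in> equivariant S \<Longrightarrow> b \<in> S \<Longrightarrow> c b \<in> carrier L"
  by (auto simp: equivariant_def)

lemma equivariant_mult:
  assumes "frob_set S" "c \<in> equivariant S" "d \<in> equivariant S"
  shows "(\<lambda>b\<in>S. c b \<otimes> d b) \<in> equivariant S"
  using assms equivariant_closed[OF assms(2)] equivariant_closed[OF assms(3)]
  by (auto simp: equivariant_def frob_set_def nat_pow_distrib)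

lemma equivariant_one: "frob_set S \<Longrightarrow> (\<lambda>b\<in>S. \<one>) \<in> equivariant S"
  by (auto simp: equivariant_def frob_set_def)

lemma equivariant_id: "frob_set S \<Longrightarrow> (\<lambda>b\<in>S. b) \<in> equivariant S"
  by (auto simp: equivariant_def frob_set_def)

lemma equivariant_inv:
  assumes "frob_set S" "c \<in> equivariant S" "\<And>b. b \<in> S \<Longrightarrow> c b \<noteq> \<zero>"
  shows "(\<lambda>b\<in>S. inv (c b)) \<in> equivariant S"
proof -
  have "inv (c b) \<in> carrier L" if "b \<in> S" for b
    using assms(3)[OF that] equivariant_closed[OF assms(2) that] by (simp add: field_Units)
  moreover have "inv (c (b [^] q)) = inv (c b) [^] q" if "b \<in> S" for b
    using assms(2,3) that equivariant_closed[OF assms(2) that] by (simp add: equivariant_def inv_nat_pow)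
  moreover have "b [^] q \<in> S" if "b \<in> S" for b
    using assms(1) that by (simp add: frob_set_def)
  ultimately show ?thesis
    unfolding equivariant_def by simp
qed

text \<open>Both sides multiply \<open>vand b\<close> by \<open>c b \<otimes> d b\<close> for each
  of the \<open>n\<close> points, and this determines a matrix.\<close>

lemma multiplier_mult:
  assumes S: "frob_set S" and c: "c \<in> equivariant S" and d: "d \<in> equivariant S"
  shows "multiplier S (\<lambda>b\<in>S. c b \<otimes> d b) = multiplier S c \<otimes>\<^bsub>Mat\<^esub> multiplier S d"
proof (rule mat_eqI[OF S])
  interpret M: monoid Mat
    by (rule monoid_mat_monoid) (rule F.ring_axioms)
  show "multiplier S c \<otimes>\<^bsub>Mat\<^esub> multiplier S d \<in> carrier Mat"
    using multiplier(1)[OF S c] multiplier(1)[OF S d] by simp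
  fix b assume b: "b \<in> S"
  note cl = equivariant_closed[OF c b] equivariant_closed[OF d b] vand_Vec[OF frob_set_closed[OF S b]]
  have "act (multiplier S c \<otimes>\<^bsub>Mat\<^esub> multiplier S d) (vand b) = smul (d b) (smul (c b) (vand b))"
    using cl multiplier[OF S c] multiplier[OF S d] b by (simp add: act_mult act_smul)
  also have "\<dots> = act (multiplier S (\<lambda>b\<in>S. c b \<otimes> d b)) (vand b)"
    using multiplier(2)[OF S equivariant_mult[OF S c d] b] b cl Vec_closed[OF cl(3)]
    by (simp add: smul_def m_ac)
  finally show "act (multiplier S (\<lambda>b\<in>S. c b \<otimes> d b)) (vand b) = act (multiplier S c \<otimes>\<^bsub>Mat\<^esub> multiplier S d) (vand b)" by simp
qed (intro multiplier(1) S equivariant_mult c d)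

lemma multiplier_one:
  assumes S: "frob_set S"
  shows "multiplier S (\<lambda>b\<in>S. \<one>) = \<one>\<^bsub>Mat\<^esub>"
proof (rule mat_eqI[OF S])
  interpret M: monoid Mat
    by (rule monoid_mat_monoid) (rule F.ring_axioms)
  show "\<one>\<^bsub>Mat\<^esub> \<in> carrier Mat"
    by simp
  fix b assume b: "b \<in> S"
  note v = vand_Vec[OF frob_set_closed[OF S b]]
  show "act (multiplier S (\<lambda>b\<in>S. \<one>)) (vand b) = act \<one>\<^bsub>Mat\<^esub> (vand b)"
    using multiplier(2)[OF S equivariant_one[OF S] b] b v Vec_closed[OF v]
    by (simp add: act_one smul_def)
qed (intro multiplier(1) S equivariant_one)

text \<open>The inverse matrix is the multiplier of the pointwise inverse of \<open>c\<close>, which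
  is again equivariant.\<close>

lemma multiplier_unit:
  assumes S: "frob_set S" and c: "c \<in> equivariant S" and nz: "\<And>b. b \<in> S \<Longrightarrow> c b \<noteq> \<zero>"
  shows "multiplier S c \<in> carrier G"
proof -
  define d where "d = (\<lambda>b\<in>S. inv (c b))"
  have d: "d \<in> equivariant S"
    unfolding d_def by (rule equivariant_inv[OF S c nz])
  have u: "c b \<in> Units L" if "b \<in> S" for b
    using nz[OF that] equivariant_closed[OF c that] by (simp add: field_Units)
  have "(\<lambda>b\<in>S. c b \<otimes> d b) = (\<lambda>b\<in>S. \<one>)" "(\<lambda>b\<in>S. d b \<otimes> c b) = (\<lambda>b\<in>S. \<one>)"
    using u by (auto simp: d_def fun_eq_iff)
  then have "multiplier S c \<otimes>\<^bsub>Mat\<^esub> multiplier S d = \<one>\<^bsub>Mat\<^esub>" "multiplier S d \<otimes>\<^bsub>Mat\<^esub> multiplier S c = \<one>\<^bsub>Mat\<^esub>"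
    using multiplier_mult[OF S c d] multiplier_mult[OF S d c] multiplier_one[OF S] by simp_all
  then show ?thesis
    using multiplier(1)[OF S c] multiplier(1)[OF S d] unfolding G_carrier Units_def by blast
qed

text \<open>The multiplier of the identity function is the companion matrix of the product of the X
  - b over \<open>S\<close>; its shift rows appear in \<open>act_companion_row\<close>.\<close>

definition companion :: "'a set \<Rightarrow> 'f mat" where
  "companion S = multiplier S (\<lambda>b\<in>S. b)"

lemma companion_G: "frob_set S \<Longrightarrow> companion S \<in> carrier G"
  unfolding companion_def by (rule multiplier_unit) (auto simp: equivariant_id frob_set_def)

lemma act_companion: "frob_set S \<Longrightarrow> b \<in> S \<Longrightarrow> act (companion S) (vand b) = smul b (vand b)"
  unfolding companion_def using multiplier(2)[OF _ equivariant_id] by simp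

lemma finsum_delta:
  assumes "k < n" "\<And>s. s < n \<Longrightarrow> u s \<in> carrier L"
  shows "(\<Oplus>s\<in>{..<n}. (if s = k then \<one> else \<zero>) \<otimes> u s) = u k"
proof -
  have "(\<Oplus>s\<in>{..<n}. (if s = k then \<one> else \<zero>) \<otimes> u s) = (\<Oplus>s\<in>{..<n}. if k = s then u s else \<zero>)"
    using assms by (intro finsum_cong') auto
  also have "\<dots> = u k"
    using assms by (intro finsum_singleton) auto
  finally show ?thesis .
qed

text \<open>For \<open>Suc r < n\<close> the monomial X^(r+1) itself has degree less than
  \<open>n\<close>, so by uniqueness it is row \<open>r\<close>.\<close>

lemma act_companion_row:
  assumes S: "frob_set S" and u: "u \<in> Vec" and r: "Suc r < n"
  shows "act (companion S) u r = u (Suc r)"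
proof -
  note C = G_Mat[OF companion_G[OF S]]
  have "h (companion S $$ (r, s)) = (if s = Suc r then \<one> else \<zero>)" if "s < n" for s
  proof (rule coeffs_eqI[OF S _ _ _ that])
    fix b assume b: "b \<in> S"
    have bL: "b \<in> carrier L"
      by (rule frob_set_closed[OF S b])
    have "(\<Oplus>s\<in>{..<n}. h (companion S $$ (r, s)) \<otimes> b [^] s) = b \<otimes> b [^] r"
      using act_vand[OF C bL, of r] act_companion[OF S b] r by (simp add: smul_def vand_def)
    also have "\<dots> = (\<Oplus>s\<in>{..<n}. (if s = Suc r then \<one> else \<zero>) \<otimes> b [^] s)"
      using finsum_delta[OF r, of "\<lambda>s. b [^] s"] bL by (simp add: m_comm)
    finally show "(\<Oplus>s\<in>{..<n}. h (companion S $$ (r, s)) \<otimes> b [^] s) =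
      (\<Oplus>s\<in>{..<n}. (if s = Suc r then \<one> else \<zero>) \<otimes> b [^] s)" .
  qed (use C r h_entry in auto)
  then have "act (companion S) u r = (\<Oplus>s\<in>{..<n}. (if s = Suc r then \<one> else \<zero>) \<otimes> u s)"
    using r Vec_closed[OF u] by (auto simp: act_def intro!: finsum_cong')
  also have "\<dots> = u (Suc r)"
    using Vec_closed[OF u] by (intro finsum_delta r)
  finally show ?thesis .
qed

text \<open>The shift rows force \<open>u (Suc r) = x \<otimes> u r\<close>. Hence eigenspaces are
  at most one-dimensional and spanned by Vandermonde columns.\<close>

lemma companion_eigenvector:
  assumes S: "frob_set S" and u: "u \<in> Vec" and x: "x \<in> carrier L"
    and eig: "act (companion S) u = smul x u"
  shows "u = smul (u 0) (vand x)"
proof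
  fix r
  have "u r = u 0 \<otimes> x [^] r" if "r < n"
    using that
  proof (induction r)
    case 0
    then show ?case using Vec_closed[OF u] by simp
  next
    case (Suc r)
    have "u (Suc r) = x \<otimes> u r"
      using act_companion_row[OF S u Suc.prems] eig by (simp add: smul_def)
    then show ?case
      using Suc Vec_closed[OF u] x by (simp add: m_ac)
  qed
  moreover have "u r = \<zero>" if "\<not> r < n"
    using u that by (simp add: Vec_def)
  ultimately show "u r = smul (u 0) (vand x) r"
    using Vec_closed[OF u] by (auto simp: smul_def vand_def)
qed

text \<open>An eigenvalue outside \<open>S\<close> would be a further solution of the equation in
  the last row: a polynomial of degree \<open>n\<close> would have \<open>n + 1\<close>
  roots.\<close>

lemma companion_eigenvalue:
  assumes S: "frob_set S" and u: "u \<in> Vec" "u \<noteq> (\<lambda>_. \<zero>)" and x: "x \<in> carrier L"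
    and eig: "act (companion S) u = smul x u"
  shows "x \<in> S"
proof (rule ccontr)
  assume xS: "x \<notin> S"
  note C = G_Mat[OF companion_G[OF S]]
  \<comment> \<open>Minus the characteristic polynomial: the last row, completed by the coefficient
    -1 of X^n.\<close>
  define c where "c = (\<lambda>s. if s < n then h (companion S $$ (n - 1, s)) else \<ominus> \<one>)"
  have cL: "c s \<in> carrier L" if "s \<le> n" for s
    using that n_pos h_entry[OF C] by (auto simp: c_def)
  have sum: "(\<Oplus>s\<in>{..<Suc n}. c s \<otimes> b [^] s) = \<ominus> (b [^] n) \<oplus> act (companion S) (vand b) (n - 1)"
    if b: "b \<in> carrier L" for b
  proof -
    have "(\<Oplus>s\<in>{..<n}. c s \<otimes> b [^] s) = (\<Oplus>s\<in>{..<n}. h (companion S $$ (n - 1, s)) \<otimes> b [^] s)"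
      using h_entry[OF C, of "n - 1"] n_pos b by (intro finsum_cong') (auto simp: c_def)
    moreover have "c n \<otimes> b [^] n = \<ominus> (b [^] n)"
      using b by (simp add: c_def l_minus)
    ultimately show ?thesis
      using cL b n_pos act_vand[OF C b, of "n - 1"] by (subst finsum_lessThan_Suc) auto
  qed
  have pow: "b \<otimes> b [^] (n - 1) = b [^] n" if "b \<in> carrier L" for b
    using that n_pos by (metis Suc_diff_1 less_eq_Suc_le nat_pow_Suc2 One_nat_def)
  have u0: "u 0 \<in> carrier L" "u 0 \<noteq> \<zero>"
  proof -
    show "u 0 \<noteq> \<zero>"
    proof
      assume "u 0 = \<zero>"
      then have "u = (\<lambda>_. \<zero>)"
        using companion_eigenvector[OF S u(1) x eig] Vec_closed[OF vand_Vec[OF x]] by (simp add: smul_def)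
      then show False using u(2) by simp
    qed
  qed (rule Vec_closed[OF u(1)])
  have v: "vand x \<in> Vec"
    by (rule vand_Vec[OF x])
  have "smul (u 0) (act (companion S) (vand x)) = smul x (smul (u 0) (vand x))"
    using act_smul[OF C v u0(1)] eig companion_eigenvector[OF S u(1) x eig] by metis
  from fun_cong[OF this, of "n - 1"]
  have "u 0 \<otimes> act (companion S) (vand x) (n - 1) = x \<otimes> (u 0 \<otimes> x [^] (n - 1))"
    using n_pos by (simp add: smul_def vand_def)
  also have "\<dots> = u 0 \<otimes> x [^] n"
    using x u0 pow[OF x, symmetric] by (simp add: m_ac)
  finally have ax: "act (companion S) (vand x) (n - 1) = x [^] n"
    using u0 x Vec_closed[OF act_Vec[OF C v]] by (simp add: m_lcancel)
  have ab: "act (companion S) (vand b) (n - 1) = b [^] n" if "b \<in> S" for b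
    using act_companion[OF S that] n_pos pow[OF frob_set_closed[OF S that]] by (simp add: smul_def vand_def)
  have fin: "finite S"
    using S n_pos by (auto simp: frob_set_def intro!: card_ge_0_finite)
  have "c n = \<zero>"
  proof (rule coeffs_zero_if_many_roots[where A = "insert x S" and d = "Suc n"])
    fix b assume b: "b \<in> insert x S"
    then have bL: "b \<in> carrier L"
      using frob_set_closed[OF S] x by auto
    have "act (companion S) (vand b) (n - 1) = b [^] n"
      using b ax ab by auto
    then show "(\<Oplus>s\<in>{..<Suc n}. c s \<otimes> b [^] s) = \<zero>"
      using sum[OF bL] bL by (simp add: l_neg)
  qed (use S x xS fin cL in \<open>auto simp: frob_set_def\<close>)
  then show False
    by (metis c_def less_irrefl minus_minus minus_zero one_closed one_not_zero)
qed

text \<open>\<open>k\<close> carries the eigenvector \<open>vand b\<close> of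
  \<open>companion S'\<close> to an eigenvector of \<open>companion S\<close> with the same
  eigenvalue, nonzero because \<open>k\<close> is invertible.\<close>

lemma intertwiner_imp_subset:
  assumes S: "frob_set S" and S': "frob_set S'" and k: "k \<in> carrier G"
    and eq: "companion S \<otimes>\<^bsub>G\<^esub> k = k \<otimes>\<^bsub>G\<^esub> companion S'"
  shows "S' \<subseteq> S"
proof
  fix b assume b: "b \<in> S'"
  have bL: "b \<in> carrier L"
    by (rule frob_set_closed[OF S' b])
  note v = vand_Vec[OF bL]
  have "act (companion S) (act k (vand b)) = act k (act (companion S') (vand b))"
    using eq act_G_mult[OF companion_G[OF S] k v] act_G_mult[OF k companion_G[OF S'] v] by simp
  also have "\<dots> = smul b (act k (vand b))"
    using act_companion[OF S' b] act_smul[OF G_Mat[OF k] v bL] by simp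
  finally have "act (companion S) (act k (vand b)) = smul b (act k (vand b))" .
  moreover have "act k (vand b) \<noteq> (\<lambda>_. \<zero>)"
  proof
    assume "act k (vand b) = (\<lambda>_. \<zero>)"
    then have "vand b = (\<lambda>_. \<zero>)"
      by (rule act_zero_imp_zero[OF k v])
    then show False
      using vand_0[of b] one_not_zero by simp
  qed
  ultimately show "b \<in> S"
    by (intro companion_eigenvalue[OF S act_Vec[OF G_Mat[OF k] v] _ bL])
qed

section \<open>Conjugacy classes and centralizers of companion matrices\<close>

definition conj_class :: "'a set \<Rightarrow> 'f mat set" where
  "conj_class S = (\<lambda>g. g \<otimes>\<^bsub>G\<^esub> companion S \<otimes>\<^bsub>G\<^esub> inv\<^bsub>G\<^esub> g) ` carrier G"

lemma G_inv_cancel: "g \<in> carrier G \<Longrightarrow> z \<in> carrier G \<Longrightarrow> inv\<^bsub>G\<^esub> g \<otimes>\<^bsub>G\<^esub> (g \<otimes>\<^bsub>G\<^esub> z) = z"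
  by (simp add: G.m_assoc[symmetric])

lemma conj_eqD:
  assumes "g \<in> carrier G" "k \<in> carrier G" "a \<in> carrier G" "b \<in> carrier G"
    and eq: "g \<otimes>\<^bsub>G\<^esub> a \<otimes>\<^bsub>G\<^esub> inv\<^bsub>G\<^esub> g = k \<otimes>\<^bsub>G\<^esub> b \<otimes>\<^bsub>G\<^esub> inv\<^bsub>G\<^esub> k"
  shows "a \<otimes>\<^bsub>G\<^esub> (inv\<^bsub>G\<^esub> g \<otimes>\<^bsub>G\<^esub> k) = (inv\<^bsub>G\<^esub> g \<otimes>\<^bsub>G\<^esub> k) \<otimes>\<^bsub>G\<^esub> b"
proof -
  have "a \<otimes>\<^bsub>G\<^esub> (inv\<^bsub>G\<^esub> g \<otimes>\<^bsub>G\<^esub> k) = inv\<^bsub>G\<^esub> g \<otimes>\<^bsub>G\<^esub> (g \<otimes>\<^bsub>G\<^esub> a \<otimes>\<^bsub>G\<^esub> inv\<^bsub>G\<^esub> g) \<otimes>\<^bsub>G\<^esub> k"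
    using assms(1-4) by (simp add: G.m_assoc G_inv_cancel)
  also have "\<dots> = (inv\<^bsub>G\<^esub> g \<otimes>\<^bsub>G\<^esub> k) \<otimes>\<^bsub>G\<^esub> b"
    unfolding eq using assms(1-4) by (simp add: G.m_assoc)
  finally show ?thesis .
qed

lemma conj_class_disjoint:
  assumes S: "frob_set S" and S': "frob_set S'" and "conj_class S \<inter> conj_class S' \<noteq> {}"
  shows "S = S'"
proof -
  have sub: "S' \<subseteq> S" if S: "frob_set S" and S': "frob_set S'" and meet: "conj_class S \<inter> conj_class S' \<noteq> {}" for S S'
  proof -
    obtain g k where g: "g \<in> carrier G" and k: "k \<in> carrier G"
      and "g \<otimes>\<^bsub>G\<^esub> companion S \<otimes>\<^bsub>G\<^esub> inv\<^bsub>G\<^esub> g = k \<otimes>\<^bsub>G\<^esub> companion S' \<otimes>\<^bsub>G\<^esub> inv\<^bsub>G\<^esub> k"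
      using meet unfolding conj_class_def by blast
    from conj_eqD[OF g k companion_G[OF S] companion_G[OF S'] this(3)] show ?thesis
      using g k by (intro intertwiner_imp_subset[OF S S']) auto
  qed
  show ?thesis
    using sub[OF S S' assms(3)] sub[OF S' S] assms(3) by (simp add: Int_commute subset_antisym)
qed

text \<open>A commuting \<open>k\<close> preserves the one-dimensional eigenspaces. The scalar is
  read off at coordinate 0, where \<open>vand b\<close> is one.\<close>

lemma commutes_companion_act:
  assumes S: "frob_set S" and k: "k \<in> carrier G"
    and eq: "companion S \<otimes>\<^bsub>G\<^esub> k = k \<otimes>\<^bsub>G\<^esub> companion S" and b: "b \<in> S"
  shows "act k (vand b) = smul (act k (vand b) 0) (vand b)"
proof (rule companion_eigenvector[OF S])
  have bL: "b \<in> carrier L"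
    by (rule frob_set_closed[OF S b])
  note v = vand_Vec[OF bL]
  show "act k (vand b) \<in> Vec"
    by (rule act_Vec[OF G_Mat[OF k] v])
  have "act (companion S) (act k (vand b)) = act k (act (companion S) (vand b))"
    using eq act_G_mult[OF companion_G[OF S] k v] act_G_mult[OF k companion_G[OF S] v] by simp
  also have "\<dots> = smul b (act k (vand b))"
    using act_companion[OF S b] act_smul[OF G_Mat[OF k] v bL] by simp
  finally show "act (companion S) (act k (vand b)) = smul b (act k (vand b))" .
qed (rule frob_set_closed[OF S b])

text \<open>Row 0 of a commuting \<open>k\<close> determines coordinate 0 of
  \<open>act k (vand b)\<close>, which is the eigenvalue of \<open>k\<close> on
  \<open>vand b\<close>; these eigenvalues determine \<open>k\<close>. There are
  \<open>q ^ n\<close> candidates for the row.\<close>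

lemma card_centralizer:
  assumes S: "frob_set S"
  shows "card {k \<in> carrier G. companion S \<otimes>\<^bsub>G\<^esub> k = k \<otimes>\<^bsub>G\<^esub> companion S} \<le> q ^ n"
proof -
  let ?Z = "{k \<in> carrier G. companion S \<otimes>\<^bsub>G\<^esub> k = k \<otimes>\<^bsub>G\<^esub> companion S}" and ?X = "{..<n} \<rightarrow>\<^sub>E carrier F"
  define row where "row = (\<lambda>A :: 'f mat. \<lambda>s\<in>{..<n}. A $$ (0, s))"
  have "inj_on row ?Z"
  proof (rule inj_onI)
    fix k l assume k: "k \<in> ?Z" and l: "l \<in> ?Z" and eq: "row k = row l"
    have kl: "k $$ (0, s) = l $$ (0, s)" if "s < n" for s
      using fun_cong[OF eq, of s] that by (simp add: row_def)
    show "k = l"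
    proof (rule mat_eqI[OF S])
      fix b assume b: "b \<in> S"
      have "act k (vand b) 0 = act l (vand b) 0"
        using kl k l n_pos Vec_closed[OF vand_Vec[OF frob_set_closed[OF S b]]] h_entry[of l 0] G_Mat[of l]
        by (auto simp: act_def intro!: finsum_cong')
      then show "act k (vand b) = act l (vand b)"
        using commutes_companion_act[OF S _ _ b, of k] commutes_companion_act[OF S _ _ b, of l] k l by simp
    qed (use k l G_Mat in auto)
  qed
  moreover have "row ` ?Z \<subseteq> ?X"
  proof (rule image_subsetI)
    fix k assume "k \<in> ?Z"
    then have "k $$ (0, s) \<in> carrier F" if "s < n" for s
      using n_pos that Mat_entry[OF G_Mat, of k 0 s] by simp
    then show "row k \<in> ?X"
      unfolding row_def by simp
  qed
  ultimately have "card ?Z \<le> card ?X"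
    using fin_F by (intro card_inj_on_le) (auto intro!: finite_PiE)
  then show ?thesis
    by (simp add: card_PiE q_def)
qed

text \<open>Orbit-stabilizer as an inequality: left translation by the inverse of \<open>g\<close>
  moves the fibre through \<open>g\<close> of the conjugation map into the centralizer.\<close>

lemma card_conj_class:
  assumes S: "frob_set S"
  shows "card (carrier G) \<le> card (conj_class S) * q ^ n"
  unfolding conj_class_def
proof (rule card_le_card_image_mult[OF finite_G])
  let ?f = "\<lambda>g. g \<otimes>\<^bsub>G\<^esub> companion S \<otimes>\<^bsub>G\<^esub> inv\<^bsub>G\<^esub> g"
  let ?Z = "{k \<in> carrier G. companion S \<otimes>\<^bsub>G\<^esub> k = k \<otimes>\<^bsub>G\<^esub> companion S}"
  fix y assume "y \<in> ?f ` carrier G"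
  then obtain g where g: "g \<in> carrier G" "y = ?f g"
    by blast
  have "inj_on (\<lambda>k. inv\<^bsub>G\<^esub> g \<otimes>\<^bsub>G\<^esub> k) {k \<in> carrier G. ?f k = y}"
    using g by (intro inj_onI) (auto simp: G.l_cancel)
  moreover have "(\<lambda>k. inv\<^bsub>G\<^esub> g \<otimes>\<^bsub>G\<^esub> k) ` {k \<in> carrier G. ?f k = y} \<subseteq> ?Z"
  proof (rule image_subsetI)
    fix k assume k: "k \<in> {k \<in> carrier G. ?f k = y}"
    then have "?f g = ?f k" using g by simp
    from conj_eqD[OF g(1) _ companion_G[OF S] companion_G[OF S] this] show "inv\<^bsub>G\<^esub> g \<otimes>\<^bsub>G\<^esub> k \<in> ?Z"
      using k g by auto
  qed
  ultimately have "card {k \<in> carrier G. ?f k = y} \<le> card ?Z"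
    using finite_G by (intro card_inj_on_le) auto
  then show "card {k \<in> carrier G. ?f k = y} \<le> q ^ n"
    using card_centralizer[OF S] by linarith
qed

lemma conj_class_carrier: "frob_set S \<Longrightarrow> conj_class S \<subseteq> carrier G"
  using companion_G by (auto simp: conj_class_def)

section \<open>M-th roots of companion matrices and of their eigenvalues\<close>

lemma multiplier_pow:
  assumes S: "frob_set S" and c: "c \<in> equivariant S" and nz: "\<And>b. b \<in> S \<Longrightarrow> c b \<noteq> \<zero>"
  shows "(\<lambda>b\<in>S. c b [^] (k::nat)) \<in> equivariant S" "multiplier S c [^]\<^bsub>G\<^esub> k = multiplier S (\<lambda>b\<in>S. c b [^] k)"
proof (induction k)
  case 0
  show "(\<lambda>b\<in>S. c b [^] (0::nat)) \<in> equivariant S"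
    using equivariant_one[OF S] by simp
  show "multiplier S c [^]\<^bsub>G\<^esub> (0::nat) = multiplier S (\<lambda>b\<in>S. c b [^] (0::nat))"
    using multiplier_one[OF S] by (simp add: G_one)
next
  case (Suc k)
  have eq: "(\<lambda>b\<in>S. (\<lambda>b\<in>S. c b [^] k) b \<otimes> c b) = (\<lambda>b\<in>S. c b [^] Suc k)"
    by (auto simp: fun_eq_iff)
  show "(\<lambda>b\<in>S. c b [^] Suc k) \<in> equivariant S"
    using equivariant_mult[OF S Suc(1) c] unfolding eq .
  show "multiplier S c [^]\<^bsub>G\<^esub> Suc k = multiplier S (\<lambda>b\<in>S. c b [^] Suc k)"
    using multiplier_mult[OF S Suc(1) c] Suc(2) unfolding eq by (simp add: G_mult)
qed

lemma conj_pow: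
  assumes "g \<in> carrier G" "a \<in> carrier G"
  shows "(g \<otimes>\<^bsub>G\<^esub> a \<otimes>\<^bsub>G\<^esub> inv\<^bsub>G\<^esub> g) [^]\<^bsub>G\<^esub> (k::nat) = g \<otimes>\<^bsub>G\<^esub> a [^]\<^bsub>G\<^esub> k \<otimes>\<^bsub>G\<^esub> inv\<^bsub>G\<^esub> g"
proof (induction k)
  case (Suc k)
  then show ?case
    using assms by (simp add: G.m_assoc G_inv_cancel)
qed (use assms in simp)

text \<open>\<open>multiplier S c\<close> is an M-th root of the companion matrix, because
  eigenvalues multiply pointwise; conjugation preserves powers.\<close>

lemma conj_class_powers:
  assumes S: "frob_set S" and c: "c \<in> equivariant S" "\<And>b. b \<in> S \<Longrightarrow> c b [^] M = b" and M: "M \<ge> 1"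
  shows "conj_class S \<subseteq> power_image G M"
proof
  fix x assume "x \<in> conj_class S"
  then obtain g where g: "g \<in> carrier G" "x = g \<otimes>\<^bsub>G\<^esub> companion S \<otimes>\<^bsub>G\<^esub> inv\<^bsub>G\<^esub> g"
    by (auto simp: conj_class_def)
  have nz: "c b \<noteq> \<zero>" if "b \<in> S" for b
    using c(2)[OF that] S that M by (auto simp: nat_pow_zero frob_set_def)
  have "multiplier S c [^]\<^bsub>G\<^esub> M = multiplier S (\<lambda>b\<in>S. c b [^] M)"
    by (rule multiplier_pow(2)[OF S c(1) nz])
  moreover have "(\<lambda>b\<in>S. c b [^] M) = (\<lambda>b\<in>S. b)"
    by (rule restrict_ext) (rule c(2))
  ultimately have "companion S = multiplier S c [^]\<^bsub>G\<^esub> M"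
    by (simp add: companion_def)
  then have "x = (g \<otimes>\<^bsub>G\<^esub> multiplier S c \<otimes>\<^bsub>G\<^esub> inv\<^bsub>G\<^esub> g) [^]\<^bsub>G\<^esub> M"
    using g conj_pow[OF g(1) multiplier_unit[OF S c(1) nz]] by simp
  moreover have "g \<otimes>\<^bsub>G\<^esub> multiplier S c \<otimes>\<^bsub>G\<^esub> inv\<^bsub>G\<^esub> g \<in> carrier G"
    using g multiplier_unit[OF S c(1) nz] by simp
  ultimately show "x \<in> power_image G M"
    unfolding power_image_def by blast
qed

text \<open>A matrix whose M-th power is \<open>companion S\<close> commutes with it, hence is
  diagonal in the columns \<open>vand b\<close>; its eigenvalues are the roots sought.\<close>

lemma powers_conj_class:
  assumes S: "frob_set S" and meet: "conj_class S \<inter> power_image G M \<noteq> {}"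
  obtains c where "c \<in> equivariant S" "\<And>b. b \<in> S \<Longrightarrow> c b [^] M = b"
proof -
  obtain g z where g: "g \<in> carrier G" and z: "z \<in> carrier G"
    and eq: "g \<otimes>\<^bsub>G\<^esub> companion S \<otimes>\<^bsub>G\<^esub> inv\<^bsub>G\<^esub> g = z [^]\<^bsub>G\<^esub> M"
    using meet unfolding conj_class_def power_image_def by blast
  define y where "y = inv\<^bsub>G\<^esub> g \<otimes>\<^bsub>G\<^esub> z \<otimes>\<^bsub>G\<^esub> inv\<^bsub>G\<^esub> (inv\<^bsub>G\<^esub> g)"
  have y: "y \<in> carrier G"
    using g z by (simp add: y_def)
  have "y [^]\<^bsub>G\<^esub> M = inv\<^bsub>G\<^esub> g \<otimes>\<^bsub>G\<^esub> (g \<otimes>\<^bsub>G\<^esub> companion S \<otimes>\<^bsub>G\<^esub> inv\<^bsub>G\<^esub> g) \<otimes>\<^bsub>G\<^esub> inv\<^bsub>G\<^esub> (inv\<^bsub>G\<^esub> g)"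
    unfolding y_def eq using g z by (intro conj_pow) auto
  also have "\<dots> = companion S"
    using g companion_G[OF S] by (simp add: G.m_assoc G_inv_cancel)
  finally have yM: "y [^]\<^bsub>G\<^esub> M = companion S" .
  have comm: "companion S \<otimes>\<^bsub>G\<^esub> y = y \<otimes>\<^bsub>G\<^esub> companion S"
    unfolding yM[symmetric] using y by (metis G.nat_pow_Suc G.nat_pow_Suc2)
  define c where "c = (\<lambda>b\<in>S. act y (vand b) 0)"
  have v: "vand b \<in> Vec" "act y (vand b) \<in> Vec" if "b \<in> S" for b
    using act_Vec[OF G_Mat[OF y]] vand_Vec[OF frob_set_closed[OF S that]] by auto
  have cL: "c b \<in> carrier L" if "b \<in> S" for b
    using Vec_closed[OF v(2)[OF that]] that by (simp add: c_def)
  have act_y: "act y (vand b) = smul (c b) (vand b)" if "b \<in> S" for b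
    using commutes_companion_act[OF S y comm that] that by (simp add: c_def)
  \<comment> \<open>The eigenvalue is coordinate 0 of the image of \<open>vand b\<close>, and it
    commutes with Frobenius because the entries of \<open>y\<close> lie in \<open>F\<close>.\<close>
  have "c \<in> equivariant S"
    using S cL act_vand_frob[OF G_Mat[OF y] frob_set_closed[OF S]] n_pos
    unfolding equivariant_def by (auto simp: c_def frob_set_def)
  moreover have "c b [^] M = b" if b: "b \<in> S" for b
  proof -
    have "act (y [^]\<^bsub>G\<^esub> k) (vand b) = smul (c b [^] k) (vand b)" for k :: nat
    proof (induction k)
      case 0
      show ?case
        using act_G_one[OF v(1)[OF b]] Vec_closed[OF v(1)[OF b]] by (simp add: smul_def)
    next
      case (Suc k)
      have "act (y [^]\<^bsub>G\<^esub> Suc k) (vand b) = smul (c b) (smul (c b [^] k) (vand b))"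
        using y Suc act_y[OF b] cL[OF b] v[OF b]
          act_G_mult[of "y [^]\<^bsub>G\<^esub> k" y "vand b"] act_smul[OF G_Mat[of "y [^]\<^bsub>G\<^esub> k"] v(1)[OF b] cL[OF b]]
        by simp
      then show ?case
        using cL[OF b] Vec_closed[OF v(1)[OF b]] by (simp add: smul_def m_ac)
    qed
    from this[of M] have "smul b (vand b) = smul (c b [^] M) (vand b)"
      using act_companion[OF S b] yM by simp
    from fun_cong[OF this, of 0] show ?thesis
      using cL[OF b] frob_set_closed[OF S b] by (simp add: smul_def vand_0)
  qed
  ultimately show thesis
    by (rule that)
qed

end

section \<open>Eigenvalue sets of a given cycle type\<close>

lemma (in domain) nonzero_pow: "x \<in> carrier R \<Longrightarrow> x \<noteq> \<zero> \<Longrightarrow> x [^] (k::nat) \<noteq> \<zero>"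
  by (induction k) (auto simp: integral_iff)

context finite_field_ext
begin

definition frob :: "nat \<Rightarrow> 'a \<Rightarrow> 'a" where
  "frob s x = x [^] (q ^ s)"

lemma frob_closed: "x \<in> carrier L \<Longrightarrow> frob s x \<in> carrier L"
  by (simp add: frob_def)

lemma frob_0: "x \<in> carrier L \<Longrightarrow> frob 0 x = x"
  by (simp add: frob_def)

lemma frob_frob: "x \<in> carrier L \<Longrightarrow> frob d (frob s x) = frob (s + d) x"
  by (simp add: frob_def nat_pow_pow power_add)

lemma frob_pow_q: "x \<in> carrier L \<Longrightarrow> frob s x [^] q = frob (Suc s) x"
  by (simp add: frob_def nat_pow_pow mult.commute)

lemma K_iff: "x \<in> K i \<longleftrightarrow> x \<in> carrier L \<and> frob i x = x"
  by (simp add: K_def frob_def)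

lemma frob_shift: "x \<in> K i \<Longrightarrow> frob (s + i) x = frob s x"
  using frob_frob[of x s i] by (simp add: K_iff frob_frob add.commute)

lemma frob_mod: "x \<in> K i \<Longrightarrow> frob (s mod i) x = frob s x"
proof -
  assume x: "x \<in> K i"
  have "frob (r + k * i) x = frob r x" for r k
  proof (induction k)
    case (Suc k)
    then show ?case
      using frob_shift[OF x, of "r + k * i"] by (simp add: ac_simps)
  qed simp
  from this[of "s mod i" "s div i"] show ?thesis
    by simp
qed

text \<open>Frobenius applied \<open>i - s\<close> more times completes a full turn on the side of
  \<open>x\<close>.\<close>

lemma frob_coincidence:
  assumes x: "x \<in> K i" and s: "s \<le> i" and y: "y \<in> carrier L" and eq: "frob s x = frob s' y"
  shows "x = frob (s' + (i - s)) y"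
proof -
  have xL: "x \<in> carrier L" using x by (simp add: K_iff)
  have "x = frob (s + (i - s)) x"
    using x s by (simp add: K_iff)
  also have "\<dots> = frob (s' + (i - s)) y"
    using frob_frob[OF xL, of "i - s" s] frob_frob[OF y, of "i - s" s'] eq by simp
  finally show ?thesis .
qed

text \<open>The exact length of the Frobenius orbit of \<open>b\<close>, equivalently its degree
  over \<open>F\<close>.\<close>

definition period :: "'a \<Rightarrow> nat \<Rightarrow> bool" where
  "period b i \<longleftrightarrow> i \<ge> 1 \<and> frob i b = b \<and> (\<forall>d. 1 \<le> d \<and> d < i \<longrightarrow> frob d b \<noteq> b)"

lemma period_unique: "period b i \<Longrightarrow> period b j \<Longrightarrow> i = j"
  unfolding period_def by (metis linorder_neqE_nat)

end

text \<open>Algebraic closedness enters the counting through the orders of the \<open>K i\<close>,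
  so these orders are what is assumed.\<close>

locale GL_closure = GL_ext F L h q n
  for F :: "('f, 'g) ring_scheme" and L :: "('a, 'b) ring_scheme" (structure) and h q n +
  assumes card_K_eq: "i \<ge> 1 \<Longrightarrow> card (K i) = q ^ i"
begin

lemma finite_K: "i \<ge> 1 \<Longrightarrow> finite (K i)"
  using card_K_eq[of i] q_ge_2 by (intro card_ge_0_finite) simp

definition K_units :: "nat \<Rightarrow> 'a set" where
  "K_units i = K i - {\<zero>}"

text \<open>The pair \<open>(i, k)\<close> stands for the \<open>k\<close>-th part equal to \<open>i\<close>; it carries \<open>i\<close> Frobenius conjugates.\<close>
definition part_index :: "(nat \<Rightarrow> nat) \<Rightarrow> (nat \<times> nat) set" where
  "part_index m = Sigma {1..n} (\<lambda>i. {..<m i})"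

definition root_index :: "(nat \<Rightarrow> nat) \<Rightarrow> ((nat \<times> nat) \<times> nat) set" where
  "root_index m = Sigma (part_index m) (\<lambda>t. {..<fst t})"

definition unit_tuples :: "(nat \<Rightarrow> nat) \<Rightarrow> (nat \<times> nat \<Rightarrow> 'a) set" where
  "unit_tuples m = PiE (part_index m) (\<lambda>t. K_units (fst t))"

definition frob_conj :: "(nat \<times> nat \<Rightarrow> 'a) \<Rightarrow> (nat \<times> nat) \<times> nat \<Rightarrow> 'a" where
  "frob_conj a j = frob (snd j) (a (fst j))"

text \<open>Injectivity covers both coincidences within the orbit of one entry and coincidences
  between different entries.\<close>

definition generic :: "(nat \<Rightarrow> nat) \<Rightarrow> (nat \<times> nat \<Rightarrow> 'a) \<Rightarrow> bool" where
  "generic m a \<longleftrightarrow> inj_on (frob_conj a) (root_index m)"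

definition conjugates :: "(nat \<Rightarrow> nat) \<Rightarrow> (nat \<times> nat \<Rightarrow> 'a) \<Rightarrow> 'a set" where
  "conjugates m a = frob_conj a ` root_index m"

definition partition_of_n :: "(nat \<Rightarrow> nat) \<Rightarrow> bool" where
  "partition_of_n m \<longleftrightarrow> (\<Sum>i=1..n. i * m i) = n"

lemma finite_part_index: "finite (part_index m)" and finite_root_index: "finite (root_index m)"
  by (auto simp: part_index_def root_index_def)

lemma part_index_fst: "t \<in> part_index m \<Longrightarrow> fst t \<ge> 1"
  by (auto simp: part_index_def)

lemma sum_part_index: "(\<Sum>t\<in>part_index m. f (fst t)) = (\<Sum>i=1..n. m i * f i)"
  using sum.Sigma[of "{1..n}" "\<lambda>i. {..<m i}" "\<lambda>i k. f i"] by (simp add: part_index_def case_prod_beta')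

lemma prod_part_index: "(\<Prod>t\<in>part_index m. f (fst t)) = (\<Prod>i=1..n. f i ^ m i)"
  using prod.Sigma[of "{1..n}" "\<lambda>i. {..<m i}" "\<lambda>i k. f i"] by (simp add: part_index_def case_prod_beta')

lemma sum_part_index_fst: "partition_of_n m \<Longrightarrow> (\<Sum>t\<in>part_index m. fst t) = n"
  using sum_part_index[of "\<lambda>i. i" m] by (simp add: partition_of_n_def mult.commute)

lemma card_root_index: "partition_of_n m \<Longrightarrow> card (root_index m) = n"
  unfolding root_index_def by (subst card_SigmaI) (auto simp: finite_part_index sum_part_index_fst)

text \<open>The exponents and the index set are left free because \<open>card_coincidence\<close>
  shrinks one exponent in one case and drops one index in the other.\<close>

lemma card_PiE_K:
  assumes "A \<subseteq> part_index m" "\<And>t. t \<in> A \<Longrightarrow> e t \<ge> 1"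
  shows "card (PiE A (\<lambda>t. K (e t))) = q ^ (\<Sum>t\<in>A. e t)" "finite (PiE A (\<lambda>t. K (e t)))"
proof -
  have fin: "finite A"
    using assms(1) finite_part_index finite_subset by blast
  show "card (PiE A (\<lambda>t. K (e t))) = q ^ (\<Sum>t\<in>A. e t)"
    using assms(2) by (simp add: card_PiE[OF fin] card_K_eq power_sum)
  show "finite (PiE A (\<lambda>t. K (e t)))"
    using assms(2) by (intro finite_PiE fin finite_K)
qed

lemma unit_tuples_D: "a \<in> unit_tuples m \<Longrightarrow> t \<in> part_index m \<Longrightarrow> a t \<in> K (fst t) \<and> a t \<noteq> \<zero> \<and> a t \<in> carrier L"
  by (auto simp: unit_tuples_def K_units_def K_def)

lemma finite_unit_tuples: "finite (unit_tuples m)"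
  unfolding unit_tuples_def K_units_def using part_index_fst finite_K by (intro finite_PiE finite_part_index) auto

text \<open>The entry at \<open>t\<close> lies in \<open>K (fst t)\<close>, so the Frobenius
  exponent wraps around modulo \<open>fst t\<close>.\<close>

lemma conjugates_closed:
  assumes a: "a \<in> unit_tuples m" and b: "b \<in> conjugates m a"
  shows "b [^] q \<in> conjugates m a"
proof -
  obtain t s where ts: "t \<in> part_index m" "s < fst t" "b = frob s (a t)"
    using b by (auto simp: conjugates_def root_index_def frob_conj_def)
  have bq: "b [^] q = frob (Suc s mod fst t) (a t)"
    using ts unit_tuples_D[OF a ts(1)] frob_pow_q frob_mod by simp
  have "(t, Suc s mod fst t) \<in> root_index m"
    using ts part_index_fst[OF ts(1)] by (auto simp: root_index_def intro!: mod_less_divisor)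
  then show ?thesis
    unfolding bq conjugates_def by (intro image_eqI) (auto simp: frob_conj_def)
qed

lemma tuple_in_conjugates:
  assumes a: "a \<in> unit_tuples m" and t: "t \<in> part_index m"
  shows "a t \<in> conjugates m a"
  unfolding conjugates_def
proof (rule image_eqI)
  show "a t = frob_conj a (t, 0)"
    using unit_tuples_D[OF a t] by (simp add: frob_conj_def frob_0)
  show "(t, 0) \<in> root_index m"
    using t part_index_fst[OF t] by (simp add: root_index_def)
qed

lemma equivariant_frob:
  assumes c: "c \<in> equivariant S" and S: "S \<subseteq> carrier L" "\<And>b. b \<in> S \<Longrightarrow> b [^] q \<in> S" and b: "b \<in> S"
  shows "frob s b \<in> S \<and> c (frob s b) = frob s (c b)"
proof (induction s)
  case 0
  then show ?case
    using b S equivariant_closed[OF c b] by (auto simp: frob_0)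
next
  case (Suc s)
  have "frob (Suc s) b = frob s b [^] q" "frob (Suc s) (c b) = frob s (c b) [^] q"
    using frob_pow_q b S equivariant_closed[OF c b] by auto
  then show ?case
    using Suc S(2) c by (simp add: equivariant_def)
qed

text \<open>An equivariant function is determined by its values at the entries \<open>a t\<close>,
  one per orbit, and equivariance puts the value at \<open>a t\<close> into
  \<open>K (fst t)\<close>. The orders of these fields multiply to \<open>q ^ n\<close>, the bound
  that \<open>frob_set\<close> asks for.\<close>

lemma frob_set_conjugates:
  assumes m: "partition_of_n m" and a: "a \<in> unit_tuples m" and g: "generic m a"
  shows "frob_set (conjugates m a)"
proof -
  let ?S = "conjugates m a"
  let ?P = "PiE (part_index m) (\<lambda>t. K (fst t))"
  have SL: "?S \<subseteq> carrier L - {\<zero>}"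
    using unit_tuples_D[OF a] by (auto simp: conjugates_def root_index_def frob_conj_def frob_def nonzero_pow)
  have ef: "c (frob s (a t)) = frob s (c (a t))" if c: "c \<in> equivariant ?S" and t: "t \<in> part_index m" for c s t
    using equivariant_frob[OF c, of "a t" s] conjugates_closed[OF a] tuple_in_conjugates[OF a t] SL by blast
  define \<rho> where "\<rho> = (\<lambda>c :: 'a \<Rightarrow> 'a. \<lambda>t\<in>part_index m. c (a t))"
  have "inj_on \<rho> (equivariant ?S)"
  proof (rule inj_onI)
    fix c d assume c: "c \<in> equivariant ?S" and d: "d \<in> equivariant ?S" and eq: "\<rho> c = \<rho> d"
    show "c = d"
    proof (rule PiE_ext)
      show "c \<in> PiE ?S (\<lambda>_. carrier L)" "d \<in> PiE ?S (\<lambda>_. carrier L)"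
        using c d by (auto simp: equivariant_def)
      fix b assume "b \<in> ?S"
      then obtain t s where ts: "t \<in> part_index m" "b = frob s (a t)"
        by (auto simp: conjugates_def root_index_def frob_conj_def)
      have "c (a t) = d (a t)"
        using fun_cong[OF eq, of t] ts(1) by (simp add: \<rho>_def)
      then show "c b = d b"
        using ef[OF c ts(1), of s] ef[OF d ts(1), of s] ts(2) by simp
    qed
  qed
  moreover have "\<rho> ` equivariant ?S \<subseteq> ?P"
  proof (rule image_subsetI)
    fix c assume c: "c \<in> equivariant ?S"
    have "c (a t) \<in> K (fst t)" if t: "t \<in> part_index m" for t
    proof -
      have "c (frob (fst t) (a t)) = frob (fst t) (c (a t))"
        by (rule ef[OF c t])
      then show ?thesis
        using unit_tuples_D[OF a t] equivariant_closed[OF c tuple_in_conjugates[OF a t]] by (auto simp: K_iff)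
    qed
    then show "\<rho> c \<in> ?P"
      by (simp add: \<rho>_def)
  qed
  moreover have "finite ?P" "card ?P = q ^ n"
    using card_PiE_K[of "part_index m" m fst] part_index_fst sum_part_index_fst[OF m] by auto
  ultimately have "finite (equivariant ?S)" "card (equivariant ?S) \<le> q ^ n"
    using inj_on_finite[of \<rho> "equivariant ?S" ?P] card_inj_on_le[of \<rho> "equivariant ?S" ?P] by auto
  moreover have "card ?S = n"
    using g card_root_index[OF m] unfolding generic_def conjugates_def by (simp add: card_image)
  ultimately show ?thesis
    unfolding frob_set_def using SL conjugates_closed[OF a] by blast
qed

text \<open>A shorter period would make two conjugates of one entry coincide, which genericity
  excludes.\<close>

lemma period_frob_conj:
  assumes a: "a \<in> unit_tuples m" and g: "generic m a" and j: "(t, s) \<in> root_index m"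
  shows "period (frob_conj a (t, s)) (fst t)"
  unfolding period_def
proof (intro conjI allI impI)
  have t: "t \<in> part_index m" "s < fst t"
    using j by (auto simp: root_index_def)
  note at = unit_tuples_D[OF a t(1)]
  show "1 \<le> fst t"
    by (rule part_index_fst[OF t(1)])
  show "frob (fst t) (frob_conj a (t, s)) = frob_conj a (t, s)"
    using at frob_frob[of "a t" "fst t" s] frob_shift[of "a t" "fst t" s] by (simp add: frob_conj_def)
  fix d assume d: "1 \<le> d \<and> d < fst t"
  show "frob d (frob_conj a (t, s)) \<noteq> frob_conj a (t, s)"
  proof
    assume "frob d (frob_conj a (t, s)) = frob_conj a (t, s)"
    then have "frob_conj a (t, (s + d) mod fst t) = frob_conj a (t, s)"
      using at frob_frob[of "a t" d s] frob_mod[of "a t" "fst t" "s + d"] by (simp add: frob_conj_def)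
    moreover have "(t, (s + d) mod fst t) \<in> root_index m"
      using t part_index_fst[OF t(1)] by (auto simp: root_index_def intro!: mod_less_divisor)
    ultimately have "(s + d) mod fst t = s"
      using g j unfolding generic_def inj_on_def by blast
    moreover have "(s + d) mod fst t \<noteq> s"
      using d t(2) by (cases "s + d < fst t") (auto simp: mod_if)
    ultimately show False by simp
  qed
qed

text \<open>The orbits of length \<open>i\<close> are those of the entries at parts
  \<open>i\<close>, so the set of eigenvalues remembers \<open>m i\<close>. This keeps sets of
  different types apart.\<close>

lemma card_conjugates_period:
  assumes a: "a \<in> unit_tuples m" and g: "generic m a" and i: "i \<in> {1..n}"
  shows "card {b \<in> conjugates m a. period b i} = m i * i"
proof -
  let ?Ji = "({i} \<times> {..<m i}) \<times> {..<i}"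
  have J: "j \<in> ?Ji \<longleftrightarrow> j \<in> root_index m \<and> fst (fst j) = i" for j
    using i by (cases j) (auto simp: root_index_def part_index_def)
  have "{b \<in> conjugates m a. period b i} = frob_conj a ` ?Ji"
  proof (intro equalityI subsetI)
    fix b assume "b \<in> {b \<in> conjugates m a. period b i}"
    then obtain t s where ts: "(t, s) \<in> root_index m" "b = frob_conj a (t, s)" "period b i"
      by (auto simp: conjugates_def)
    then have "fst t = i"
      using period_frob_conj[OF a g ts(1)] period_unique by blast
    then show "b \<in> frob_conj a ` ?Ji"
      using ts J[of "(t, s)"] by (intro image_eqI[of b _ "(t, s)"]) auto
  next
    fix b assume "b \<in> frob_conj a ` ?Ji"
    then obtain j where j: "j \<in> ?Ji" "b = frob_conj a j"
      by blast
    then have "j \<in> root_index m" "fst (fst j) = i"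
      using J by auto
    then show "b \<in> {b \<in> conjugates m a. period b i}"
      using period_frob_conj[OF a g, of "fst j" "snd j"] j by (auto simp: conjugates_def)
  qed
  moreover have "inj_on (frob_conj a) ?Ji"
    using g J inj_on_subset[of "frob_conj a" "root_index m" ?Ji] unfolding generic_def by blast
  ultimately show ?thesis
    by (simp add: card_image)
qed

lemma conjugates_eq_imp_type_eq:
  assumes "a \<in> unit_tuples m" "generic m a" "a' \<in> unit_tuples m'" "generic m' a'" "conjugates m a = conjugates m' a'" "i \<in> {1..n}"
  shows "m i = m' i"
  using card_conjugates_period[OF assms(1,2,6)] card_conjugates_period[OF assms(3,4,6)] assms(5,6) by simp

section \<open>M-th powers among the eigenvalues\<close>

definition K_powers :: "nat \<Rightarrow> nat \<Rightarrow> 'a set" where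
  "K_powers M i = (\<lambda>y. y [^] M) ` K_units i"

text \<open>A root of each entry is chosen inside the same field and transported along the orbit by
  Frobenius. Genericity makes this well defined, and a full turn returns the chosen root because it
  lies in \<open>K (fst t)\<close>.\<close>

lemma powers_imp_equivariant:
  assumes a: "a \<in> unit_tuples m" and g: "generic m a" and K_powers: "\<And>t. t \<in> part_index m \<Longrightarrow> a t \<in> K_powers M (fst t)"
  obtains c where "c \<in> equivariant (conjugates m a)" "\<And>b. b \<in> conjugates m a \<Longrightarrow> c b [^] M = b"
proof -
  have "\<forall>t\<in>part_index m. \<exists>y. y \<in> K_units (fst t) \<and> a t = y [^] M"
    using K_powers unfolding K_powers_def by blast
  then obtain y where y: "\<And>t. t \<in> part_index m \<Longrightarrow> y t \<in> K_units (fst t)" "\<And>t. t \<in> part_index m \<Longrightarrow> a t = y t [^] M"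
    by metis
  have yK: "y t \<in> K (fst t)" "y t \<in> carrier L" if "t \<in> part_index m" for t
    using y(1)[OF that] by (auto simp: K_units_def K_iff)
  define c where "c = (\<lambda>b\<in>conjugates m a. frob_conj y (the_inv_into (root_index m) (frob_conj a) b))"
  have c: "c (frob_conj a j) = frob_conj y j" if "j \<in> root_index m" for j
    using g that by (simp add: c_def conjugates_def generic_def the_inv_into_f_f)
  \<comment> \<open>Here \<open>s\<close> may exceed the orbit length, as happens when the last
    conjugate is raised to the power \<open>q\<close>; both sides depend only on
    \<open>s mod fst t\<close>.\<close>
  have c': "c (frob s (a t)) = frob s (y t)" if t: "t \<in> part_index m" for t s
  proof -
    have "(t, s mod fst t) \<in> root_index m"
      using that part_index_fst[OF t] by (auto simp: root_index_def intro!: mod_less_divisor)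
    from c[OF this] show ?thesis
      using unit_tuples_D[OF a t] yK[OF t] by (simp add: frob_conj_def frob_mod)
  qed
  show thesis
  proof (rule that[of c])
    show "c \<in> equivariant (conjugates m a)"
      unfolding equivariant_def
    proof (intro CollectI conjI ballI)
      show "c \<in> conjugates m a \<rightarrow>\<^sub>E carrier L"
      proof (rule PiE_I)
        fix b assume "b \<in> conjugates m a"
        then obtain t s where "t \<in> part_index m" "b = frob s (a t)"
          by (auto simp: conjugates_def root_index_def frob_conj_def)
        then show "c b \<in> carrier L"
          using c' yK frob_closed by simp
      qed (simp add: c_def)
      fix b assume "b \<in> conjugates m a"
      then obtain t s where "t \<in> part_index m" "b = frob s (a t)"
        by (auto simp: conjugates_def root_index_def frob_conj_def)
      then show "c (b [^] q) = c b [^] q"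
        using c' yK frob_pow_q unit_tuples_D[OF a] by simp
    qed
    fix b assume "b \<in> conjugates m a"
    then obtain t s where "t \<in> part_index m" "b = frob s (a t)"
      by (auto simp: conjugates_def root_index_def frob_conj_def)
    then show "c b [^] M = b"
      using c' yK y(2) by (simp add: frob_def nat_pow_pow mult.commute)
  qed
qed

text \<open>\<open>frob (fst t)\<close> fixes \<open>a t\<close>, hence by equivariance also the
  root \<open>c (a t)\<close>, which therefore lies in \<open>K (fst t)\<close>.\<close>

lemma equivariant_imp_powers:
  assumes a: "a \<in> unit_tuples m" and M: "M \<ge> 1"
    and c: "c \<in> equivariant (conjugates m a)" "\<And>b. b \<in> conjugates m a \<Longrightarrow> c b [^] M = b" and t: "t \<in> part_index m"
  shows "a t \<in> K_powers M (fst t)"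
  unfolding K_powers_def
proof (rule image_eqI)
  have S: "conjugates m a \<subseteq> carrier L"
    using unit_tuples_D[OF a] by (auto simp: conjugates_def root_index_def frob_conj_def frob_closed)
  note at = tuple_in_conjugates[OF a t]
  show "a t = c (a t) [^] M"
    using c(2)[OF at] by simp
  then have "c (a t) \<noteq> \<zero>"
    using unit_tuples_D[OF a t] M by (auto simp: nat_pow_zero)
  moreover have "c (frob (fst t) (a t)) = frob (fst t) (c (a t))"
    using equivariant_frob[OF c(1) S _ at, of "fst t"] conjugates_closed[OF a] by blast
  ultimately show "c (a t) \<in> K_units (fst t)"
    using unit_tuples_D[OF a t] equivariant_closed[OF c(1) at] by (simp add: K_units_def K_iff)
qed

end

section \<open>Counting tuples: fibres and coincidences\<close>

lemma card_injections: "card {f \<in> {..<k} \<rightarrow>\<^sub>E {..<k :: nat}. inj_on f {..<k}} = fact k"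
  using card_inj_on_subset_funcset[of "{..<k}" "{..<k}" "{..<k}"] by (simp add: fact_prod_rev)

lemma (in field) card_roots_of_unity:
  assumes A: "A \<subseteq> carrier R" "\<And>x. x \<in> A \<Longrightarrow> x [^] k = \<one>" and k: "k \<ge> (1::nat)"
  shows "card A \<le> k"
proof (rule ccontr)
  assume *: "\<not> card A \<le> k"
  define f where "f = (\<lambda>x. (x \<oplus> \<zero>) [^] k \<oplus> \<ominus> \<one>)"
  have pf: "polyfun (Suc k) f"
    unfolding f_def by (intro polyfun_add polyfun_linear_pow polyfun_mono[OF polyfun_const]) auto
  have f0: "f x = \<zero>" if "x \<in> A" for x
    using subsetD[OF A(1) that] A(2)[OF that] by (simp add: f_def r_neg)
  \<comment> \<open>More than \<open>k\<close> zeros make X^k - 1 vanish everywhere, in particular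
    at zero, where its value is -1.\<close>
  have "f \<zero> = \<zero>"
    by (rule polyfun_zero_if_many_roots[OF pf A(1) _ f0 zero_closed]) (use * in auto)
  then have "\<ominus> \<one> = \<zero>"
    using k by (simp add: f_def nat_pow_zero)
  then show False
    by (metis minus_minus minus_zero one_closed one_not_zero)
qed

context GL_closure
begin

text \<open>Relative to one tuple \<open>a0\<close> over \<open>S\<close>, an entry of another tuple
  at a part \<open>i\<close> is a conjugate of an entry of \<open>a0\<close> at a part
  \<open>i\<close>, since periods agree. It is described by which entry (\<open>\<kappa>\<close>)
  and which conjugate (\<open>\<sigma>\<close>). For each \<open>i\<close> these data are an
  injection of \<open>m i\<close> slots into themselves and \<open>m i\<close> shifts below
  \<open>i\<close>, and they recover the tuple.\<close>

lemma card_conjugates_fiber: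
  "card {a \<in> unit_tuples m. generic m a \<and> conjugates m a = S} \<le> (\<Prod>i=1..n. fact (m i) * i ^ m i)"
proof (cases "{a \<in> unit_tuples m. generic m a \<and> conjugates m a = S} = {}")
  case False
  then obtain a0 where a0: "a0 \<in> unit_tuples m" "generic m a0" "conjugates m a0 = S"
    by blast
  define P where "P = (\<Pi>\<^sub>E i\<in>{1..n}. {f \<in> {..<m i} \<rightarrow>\<^sub>E {..<m i}. inj_on f {..<m i}} \<times> ({..<m i} \<rightarrow>\<^sub>E {..<i}))"
  define \<Psi> where "\<Psi> = (\<lambda>x. \<lambda>t\<in>part_index m. frob (snd (x (fst t)) (snd t)) (a0 (fst t, fst (x (fst t)) (snd t))))"
  have f1: "finite {f \<in> {..<k} \<rightarrow>\<^sub>E {..<k :: nat}. inj_on f {..<k}}" for k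
    by (rule finite_subset[of _ "{..<k} \<rightarrow>\<^sub>E {..<k}"]) (auto intro!: finite_PiE)
  have f2: "finite ({..<k} \<rightarrow>\<^sub>E {..<i :: nat})" for k i :: nat
    by (intro finite_PiE) auto
  have finP: "finite P"
    unfolding P_def by (rule finite_PiE) (simp_all only: finite_atLeastAtMost finite_cartesian_product f1 f2)
  have "{a \<in> unit_tuples m. generic m a \<and> conjugates m a = S} \<subseteq> \<Psi> ` P"
  proof
    fix a assume "a \<in> {a \<in> unit_tuples m. generic m a \<and> conjugates m a = S}"
    then have a: "a \<in> unit_tuples m" "generic m a" "conjugates m a = S"
      by auto
    have "\<exists>k s. k < m (fst t) \<and> s < fst t \<and> a t = frob s (a0 (fst t, k))" if t: "t \<in> part_index m" for t
    proof -
      have "a t \<in> conjugates m a0"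
        using tuple_in_conjugates[OF a(1) t] a(3) a0(3) by simp
      then obtain j where j: "j \<in> root_index m" "a t = frob_conj a0 j"
        by (auto simp: conjugates_def)
      have "(t, 0) \<in> root_index m" "frob_conj a (t, 0) = a t"
        using t part_index_fst[OF t] unit_tuples_D[OF a(1) t] by (auto simp: root_index_def frob_conj_def frob_0)
      then have "period (a t) (fst t)"
        using period_frob_conj[OF a(1,2), of t 0] by simp
      moreover have "period (a t) (fst (fst j))"
        using period_frob_conj[OF a0(1,2), of "fst j" "snd j"] j by simp
      ultimately have eq: "fst (fst j) = fst t"
        using period_unique by blast
      show ?thesis
        using j eq by (intro exI[of _ "snd (fst j)"] exI[of _ "snd j"]) (auto simp: root_index_def part_index_def frob_conj_def)
    qed
    then obtain \<kappa> \<sigma> where ks: "\<And>t. t \<in> part_index m \<Longrightarrow> \<kappa> t < m (fst t)" "\<And>t. t \<in> part_index m \<Longrightarrow> \<sigma> t < fst t"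
      "\<And>t. t \<in> part_index m \<Longrightarrow> a t = frob (\<sigma> t) (a0 (fst t, \<kappa> t))"
      by metis
    have II: "(i, k) \<in> part_index m \<longleftrightarrow> i \<in> {1..n} \<and> k < m i" for i k
      by (auto simp: part_index_def)
    define x where "x = (\<lambda>i\<in>{1..n}. (\<lambda>k\<in>{..<m i}. \<kappa> (i, k), \<lambda>k\<in>{..<m i}. \<sigma> (i, k)))"
    \<comment> \<open>Two slots sent to the same entry of \<open>a0\<close> would carry conjugate
      entries of \<open>a\<close>, against its genericity.\<close>
    have inj: "inj_on (\<lambda>k. \<kappa> (i, k)) {..<m i}" if i: "i \<in> {1..n}" for i
    proof (rule inj_onI)
      fix k l assume kl: "k \<in> {..<m i}" "l \<in> {..<m i}" "\<kappa> (i, k) = \<kappa> (i, l)"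
      then have t: "(i, k) \<in> part_index m" "(i, l) \<in> part_index m"
        using i by (auto simp: II)
      define y where "y = a0 (i, \<kappa> (i, k))"
      have "(i, \<kappa> (i, k)) \<in> part_index m"
        using ks(1)[OF t(1)] i by (simp add: II)
      from unit_tuples_D[OF a0(1) this] have y: "y \<in> K i" "y \<in> carrier L"
        by (auto simp: y_def)
      have ak: "a (i, k) = frob (\<sigma> (i, k)) y" and al: "a (i, l) = frob (\<sigma> (i, l)) y"
        using ks(3)[OF t(1)] ks(3)[OF t(2)] kl(3) by (auto simp: y_def)
      have aL: "a (i, k) \<in> carrier L" "a (i, k) \<in> K i" "a (i, l) \<in> carrier L"
        using unit_tuples_D[OF a(1) t(1)] unit_tuples_D[OF a(1) t(2)] by auto
      have "\<sigma> (i, k) \<le> i"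
        using ks(2)[OF t(1)] by simp
      then have "y = frob (0 + (i - \<sigma> (i, k))) (a (i, k))"
        using ak aL by (intro frob_coincidence[OF y(1)]) (auto simp: frob_0)
      then have "a (i, l) = frob ((i - \<sigma> (i, k)) + \<sigma> (i, l)) (a (i, k))"
        using al frob_frob[OF aL(1)] by simp
      also have "\<dots> = frob (((i - \<sigma> (i, k)) + \<sigma> (i, l)) mod i) (a (i, k))"
        using frob_mod[OF aL(2)] by simp
      finally have "frob_conj a ((i, l), 0) = frob_conj a ((i, k), ((i - \<sigma> (i, k)) + \<sigma> (i, l)) mod i)"
        using aL by (simp add: frob_conj_def frob_0)
      moreover have "((i, l), 0) \<in> root_index m" "((i, k), ((i - \<sigma> (i, k)) + \<sigma> (i, l)) mod i) \<in> root_index m"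
        using t i by (auto simp: root_index_def)
      ultimately have "((i, l), 0) = ((i, k), ((i - \<sigma> (i, k)) + \<sigma> (i, l)) mod i)"
        using a(2) unfolding generic_def inj_on_def by blast
      then show "k = l" by simp
    qed
    have "x \<in> P"
      unfolding P_def
    proof (rule PiE_I)
      fix i assume i: "i \<in> {1..n}"
      show "x i \<in> {f \<in> {..<m i} \<rightarrow>\<^sub>E {..<m i}. inj_on f {..<m i}} \<times> ({..<m i} \<rightarrow>\<^sub>E {..<i})"
      proof -
        have k: "\<kappa> (i, k) < m i" "\<sigma> (i, k) < i" if "k < m i" for k
          using ks(1)[of "(i, k)"] ks(2)[of "(i, k)"] that i II by auto
        show ?thesis
          using i k inj[OF i] by (simp add: x_def)
      qed
    qed (auto simp: x_def)
    moreover have "a = \<Psi> x"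
    proof (rule PiE_ext)
      show "a \<in> PiE (part_index m) (\<lambda>t. K_units (fst t))"
        using a(1) by (simp add: unit_tuples_def)
      show aeq: "a t = \<Psi> x t" if "t \<in> part_index m" for t
        using ks(3)[OF that] that by (cases t) (auto simp: \<Psi>_def x_def part_index_def)
      show "\<Psi> x \<in> PiE (part_index m) (\<lambda>t. K_units (fst t))"
      proof (rule PiE_I)
        fix t assume t: "t \<in> part_index m"
        show "\<Psi> x t \<in> K_units (fst t)"
          unfolding aeq[OF t, symmetric] using a(1) t by (auto simp: unit_tuples_def)
      qed (simp add: \<Psi>_def)
    qed
    ultimately show "a \<in> \<Psi> ` P"
      by blast
  qed
  then have "card {a \<in> unit_tuples m. generic m a \<and> conjugates m a = S} \<le> card P"
    using surj_card_le[OF finP] by blast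
  also have "card P = (\<Prod>i=1..n. fact (m i) * i ^ m i)"
    unfolding P_def by (simp add: card_PiE card_cartesian_product card_injections)
  finally show ?thesis .
qed (simp only: card.empty le0)

text \<open>A coincidence costs at least one factor \<open>q\<close>: within one part it puts the
  entry into a \<open>K\<close> of smaller index, and between two parts it makes one entry a
  function of the other.\<close>

lemma card_coincidence:
  assumes m: "partition_of_n m" and j: "j \<in> root_index m" "j' \<in> root_index m" "j \<noteq> j'"
  shows "card {a \<in> unit_tuples m. frob_conj a j = frob_conj a j'} \<le> q ^ (n - 1)"
proof -
  obtain t s t' s' where js: "j = (t, s)" "j' = (t', s')"
    by (cases j, cases j') auto
  have t: "t \<in> part_index m" "s < fst t" and t': "t' \<in> part_index m" "s' < fst t'"
    using j js by (auto simp: root_index_def)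
  show ?thesis
  proof (cases "t = t'")
    case True
    have main: "card {a \<in> unit_tuples m. frob s (a t) = frob s' (a t)} \<le> q ^ (n - 1)"
      if s: "s < s'" "s' < fst t" for s s'
    proof -
      \<comment> \<open>Frobenius applied \<open>fst t - s'\<close> times to the coincidence turns
        its right side into \<open>a t\<close>. From \<open>s < s'\<close> and
        \<open>s' < fst t\<close> the new exponent at \<open>t\<close> is at least 1 and less than
        \<open>fst t\<close>.\<close>
      define e where "e = (\<lambda>t'. if t' = t then s + (fst t - s') else fst t')"
      have e1: "e u \<ge> 1" if "u \<in> part_index m" for u
        using s part_index_fst[OF that] by (auto simp: e_def)
      have sub: "{a \<in> unit_tuples m. frob s (a t) = frob s' (a t)} \<subseteq> PiE (part_index m) (\<lambda>t. K (e t))"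
      proof
        fix a assume a: "a \<in> {a \<in> unit_tuples m. frob s (a t) = frob s' (a t)}"
        then have aT: "a \<in> unit_tuples m" by simp
        have "a t = frob (s + (fst t - s')) (a t)"
          using a s unit_tuples_D[OF aT t(1)] by (intro frob_coincidence[of "a t" "fst t" s' "a t" s]) auto
        then have "a u \<in> K (e u)" if "u \<in> part_index m" for u
          using unit_tuples_D[OF aT that] by (auto simp: e_def K_iff)
        then show "a \<in> PiE (part_index m) (\<lambda>t. K (e t))"
          using aT by (auto simp: unit_tuples_def)
      qed
      have "finite (PiE (part_index m) (\<lambda>t. K (e t)))" "card (PiE (part_index m) (\<lambda>t. K (e t))) = q ^ (\<Sum>t\<in>part_index m. e t)"
        using card_PiE_K[of "part_index m" m e] e1 by blast+
      then have "card {a \<in> unit_tuples m. frob s (a t) = frob s' (a t)} \<le> q ^ (\<Sum>t\<in>part_index m. e t)"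
        using card_mono[OF _ sub] by simp
      moreover have "(\<Sum>t\<in>part_index m. e t) < (\<Sum>t\<in>part_index m. fst t)"
        using s t(1) finite_part_index by (intro sum_strict_mono_ex1) (auto simp: e_def intro!: bexI[of _ t])
      then have "q ^ (\<Sum>t\<in>part_index m. e t) \<le> q ^ (n - 1)"
        using q_ge_2 sum_part_index_fst[OF m] by (intro power_increasing) auto
      ultimately show ?thesis
        by linarith
    qed
    have "s < s' \<or> s' < s"
      using j js True by auto
    then show ?thesis
    proof
      assume "s < s'"
      then show ?thesis
        using main[of s s'] t' True js by (simp add: frob_conj_def)
    next
      assume "s' < s"
      then show ?thesis
        using main[of s' s] t True js by (simp add: frob_conj_def eq_commute)
    qed
  next
    case False
    let ?B = "{a \<in> unit_tuples m. frob_conj a j = frob_conj a j'}" and ?A = "part_index m - {t}"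
    \<comment> \<open>The entry at \<open>t\<close> is a fixed Frobenius iterate of the one at
      \<open>t'\<close>, so forgetting it loses nothing.\<close>
    have "inj_on (\<lambda>a. restrict a ?A) ?B"
    proof (rule inj_onI)
      fix a b assume a: "a \<in> ?B" and b: "b \<in> ?B" and eq: "restrict a ?A = restrict b ?A"
      have ab: "a u = b u" if "u \<in> ?A" for u
        using fun_cong[OF eq, of u] that by simp
      have tt: "c t = frob (s' + (fst t - s)) (c t')" if c: "c \<in> ?B" for c
        using c js unit_tuples_D[of c m] t t' by (intro frob_coincidence[of "c t" "fst t" s]) (auto simp: frob_conj_def)
      have "a t' = b t'"
        using ab[of t'] t' False by auto
      then have "a t = b t"
        using tt[OF a] tt[OF b] by simp
      then have "a u = b u" if "u \<in> part_index m" for u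
        using ab that by blast
      then show "a = b"
        using a b unfolding unit_tuples_def by (intro PiE_ext[of a "part_index m" "\<lambda>t. K_units (fst t)" b]) auto
    qed
    moreover have "(\<lambda>a. restrict a ?A) ` ?B \<subseteq> PiE ?A (\<lambda>t. K (fst t))"
    proof (rule image_subsetI)
      fix a assume "a \<in> ?B"
      then have "a u \<in> K (fst u)" if "u \<in> ?A" for u
        using unit_tuples_D[of a m u] that by blast
      then show "restrict a ?A \<in> PiE ?A (\<lambda>t. K (fst t))"
        by simp
    qed
    moreover have "finite (PiE ?A (\<lambda>t. K (fst t)))"
      by (rule card_PiE_K(2)[of ?A m fst]) (use part_index_fst in blast)+
    ultimately have "card ?B \<le> card (PiE ?A (\<lambda>t. K (fst t)))"
      by (rule card_inj_on_le)
    also have "\<dots> = q ^ (\<Sum>u\<in>?A. fst u)"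
      by (rule card_PiE_K(1)[of ?A m fst]) (use part_index_fst in blast)+
    also have "(\<Sum>u\<in>?A. fst u) = n - fst t"
      using sum_part_index_fst[OF m] t(1) finite_part_index[of m] by (simp add: sum_diff1_nat)
    also have "q ^ (n - fst t) \<le> q ^ (n - 1)"
      using q_ge_2 part_index_fst[OF t(1)] by (intro power_increasing) auto
    finally show ?thesis .
  qed
qed

text \<open>A union bound over at most \<open>n\<^sup>2\<close> ordered pairs of conjugates; the
  source of the quadratic term in the final constant.\<close>

lemma card_not_generic:
  assumes m: "partition_of_n m"
  shows "card {a \<in> unit_tuples m. \<not> generic m a} \<le> n\<^sup>2 * q ^ (n - 1)"
proof -
  let ?P = "{p \<in> root_index m \<times> root_index m. fst p \<noteq> snd p}"
  have fin: "finite ?P"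
    using finite_root_index by auto
  have "card ?P \<le> card (root_index m \<times> root_index m)"
    using finite_root_index by (intro card_mono) auto
  then have cP: "card ?P \<le> n\<^sup>2"
    using card_root_index[OF m] by (simp add: card_cartesian_product power2_eq_square)
  have "{a \<in> unit_tuples m. \<not> generic m a} \<subseteq> (\<Union>p\<in>?P. {a \<in> unit_tuples m. frob_conj a (fst p) = frob_conj a (snd p)})"
    unfolding generic_def inj_on_def by fastforce
  then have "card {a \<in> unit_tuples m. \<not> generic m a} \<le> card (\<Union>p\<in>?P. {a \<in> unit_tuples m. frob_conj a (fst p) = frob_conj a (snd p)})"
    using finite_unit_tuples by (intro card_mono) (auto intro: finite_subset[of _ "unit_tuples m"])
  also have "\<dots> \<le> (\<Sum>p\<in>?P. card {a \<in> unit_tuples m. frob_conj a (fst p) = frob_conj a (snd p)})"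
    by (rule card_UN_le[OF fin])
  also have "\<dots> \<le> (\<Sum>p\<in>?P. q ^ (n - 1))"
    using card_coincidence[OF m] by (intro sum_mono) auto
  also have "\<dots> \<le> n\<^sup>2 * q ^ (n - 1)"
    using cP by simp
  finally show ?thesis .
qed

section \<open>Powers in the multiplicative group of \<open>K i\<close>\<close>

lemma K_units_iff: "x \<in> K_units i \<longleftrightarrow> x \<in> carrier L \<and> x \<noteq> \<zero> \<and> x [^] (q ^ i - 1) = \<one>"
proof -
  have "q ^ i = Suc (q ^ i - 1)"
    using q_ge_2 by simp
  then have "x [^] (q ^ i) = x [^] (q ^ i - 1) \<otimes> x" if "x \<in> carrier L" for x
    by (metis nat_pow_Suc)
  then show ?thesis
    by (auto simp: K_units_def K_def) (metis l_one m_rcancel nat_pow_closed one_closed)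
qed

lemma K_powers_subset_K_units: "K_powers M i \<subseteq> K_units i"
  by (auto simp: K_powers_def K_units_iff nonzero_pow nat_pow_pow mult.commute[of M]) (metis nat_pow_one nat_pow_pow)

lemma card_K_units: "i \<ge> 1 \<Longrightarrow> card (K_units i) = q ^ i - 1"
proof -
  assume i: "i \<ge> 1"
  have "q ^ i \<noteq> 0"
    using q_ge_2 by simp
  then have "\<zero> \<in> K i"
    by (simp add: K_def nat_pow_zero)
  then show ?thesis
    using card_K_eq[OF i] finite_K[OF i] by (simp add: K_units_def)
qed

lemma pow_gcd_eq_one:
  assumes x: "x \<in> carrier L" "x \<noteq> \<zero>" and "x [^] (k::nat) = \<one>" "x [^] (l::nat) = \<one>"
  shows "x [^] gcd k l = \<one>"
proof -
  interpret X: group "Multiplicative_Group.mult_of L"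
    by (rule field_mult_group)
  show ?thesis
    using X.pow_eq_id[of x] assms by (simp add: Multiplicative_Group.nat_pow_mult_of)
qed

text \<open>With N = q^i - 1 and g = gcd M N, both bounds count roots of unity. Every M-th power is
  an (N/g)-th root of unity, and a fibre of the M-th power map, divided by one of its members,
  consists of g-th roots of unity.\<close>

lemma card_K_powers:
  assumes i: "i \<ge> 1" and M: "M \<ge> 1"
  shows "card (K_powers M i) * gcd M (q ^ i - 1) = q ^ i - 1"
proof (rule antisym)
  define N where "N = q ^ i - 1"
  define g where "g = gcd M N"
  have "q ^ 1 \<le> q ^ i"
    using i q_ge_2 by (intro power_increasing) auto
  then have N: "N \<ge> 1"
    using q_ge_2 by (simp add: N_def)
  have g: "g \<ge> 1"
    using M by (simp add: g_def Suc_le_eq)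
  have Ng: "N = N div g * g"
    by (simp add: g_def)
  have Ng1: "N div g \<ge> 1"
    using N Ng by (cases "N div g") auto
  have Wroot: "w [^] (N div g) = \<one>" if w: "w \<in> K_powers M i" for w
  proof -
    obtain x where x: "x \<in> K_units i" "w = x [^] M"
      using w by (auto simp: K_powers_def)
    obtain a b where "N = g * a" "M = g * b"
      unfolding g_def by (meson dvdE gcd_dvd1 gcd_dvd2)
    then have "M * (N div g) = N * (M div g)"
      using g by simp
    then have "w [^] (N div g) = (x [^] N) [^] (M div g)"
      using x by (simp add: nat_pow_pow K_units_iff)
    then show ?thesis
      using x by (simp add: K_units_iff N_def)
  qed
  have "K_powers M i \<subseteq> carrier L"
    using K_powers_subset_K_units[of M i] K_units_iff by blast
  then have "card (K_powers M i) \<le> N div g"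
    by (rule card_roots_of_unity[OF _ Wroot Ng1])
  then show "card (K_powers M i) * gcd M (q ^ i - 1) \<le> q ^ i - 1"
    using Ng unfolding g_def N_def by (metis mult_le_mono1)
  have fin: "finite (K_units i)"
    using finite_K[OF i] by (simp add: K_units_def)
  have "card (K_units i) \<le> card ((\<lambda>y. y [^] M) ` K_units i) * g"
  proof (rule card_le_card_image_mult[OF fin])
    fix y assume "y \<in> (\<lambda>y. y [^] M) ` K_units i"
    then obtain x where x: "x \<in> K_units i" "y = x [^] M"
      by blast
    have xu: "x \<in> Units L" "x \<in> carrier L"
      using x by (auto simp: K_units_iff field_Units)
    let ?A = "{z \<in> K_units i. z [^] M = y}"
    have "inj_on (\<lambda>z. z \<otimes> inv x) ?A"
    proof (rule inj_onI)
      fix u v assume uv: "u \<in> ?A" "v \<in> ?A" "u \<otimes> inv x = v \<otimes> inv x"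
      have w: "w \<otimes> inv x \<otimes> x = w" if "w \<in> carrier L" for w
        using that xu by (simp add: m_assoc)
      have "u \<in> carrier L" "v \<in> carrier L"
        using uv(1,2) K_units_iff by blast+
      then show "u = v"
        using w uv(3) by metis
    qed
    moreover have "card ((\<lambda>z. z \<otimes> inv x) ` ?A) \<le> g"
    proof (rule card_roots_of_unity[OF _ _ g])
      fix z assume "z \<in> (\<lambda>z. z \<otimes> inv x) ` ?A"
      then obtain u where u: "u \<in> K_units i" "u [^] M = y" "z = u \<otimes> inv x"
        by blast
      have ix: "inv x \<in> carrier L" "inv x \<noteq> \<zero>"
        using Units_inv_Units[OF xu(1)] unfolding field_Units by auto
      have uc: "u \<in> carrier L" "u \<noteq> \<zero>" "x \<noteq> \<zero>"
        using u(1) x(1) K_units_iff by blast+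
      have z: "z \<in> carrier L" "z \<noteq> \<zero>"
        using u(3) uc ix by (auto simp: integral_iff)
      have "z [^] k = u [^] k \<otimes> inv (x [^] k)" for k :: nat
        unfolding u(3) inv_nat_pow[OF xu(2) uc(3)] by (rule nat_pow_distrib[OF uc(1) ix(1)])
      moreover have "x [^] k \<in> Units L" for k :: nat
        using xu(1) by (rule Units_pow_closed)
      moreover have "x [^] N = \<one>" "u [^] N = \<one>" "u [^] M = x [^] M"
        using u x by (simp_all add: K_units_iff N_def)
      ultimately have "z [^] M = \<one>" "z [^] N = \<one>"
        by simp_all
      then show "z [^] g = \<one>"
        unfolding g_def by (rule pow_gcd_eq_one[OF z])
    qed (use xu in \<open>auto simp: K_units_iff\<close>)
    ultimately show "card ?A \<le> g"
      by (simp add: card_image)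
  qed
  then show "q ^ i - 1 \<le> card (K_powers M i) * gcd M (q ^ i - 1)"
    using card_K_units[OF i] by (simp add: K_powers_def g_def N_def)
qed

end

section \<open>Summing over the partitions\<close>

lemma partition_part_bounds:
  assumes "\<nu> \<in> partitions_of n" "i \<in># \<nu>"
  shows "i \<in> {1..n}"
proof -
  have "i \<le> \<Sum>\<^sub># \<nu>"
    using assms(2) by (metis add_leD1 multi_member_split order_refl sum_mset.add_mset)
  then show ?thesis
    using assms by (cases i) (auto simp: partitions_of_def)
qed

lemma sum_parts_eq:
  assumes "\<nu> \<in> partitions_of n"
  shows "(\<Sum>i=1..n. i * count \<nu> i) = n"
proof -
  have "(\<Sum>i=1..n. i * count \<mu> i) = \<Sum>\<^sub># \<mu>" if "set_mset \<mu> \<subseteq> {1..n}" for \<mu>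
    using that
  proof (induction \<mu>)
    case (add x \<mu>)
    have "(\<Sum>i=1..n. i * count (add_mset x \<mu>) i) = (\<Sum>i=1..n. i * count \<mu> i + (if i = x then x else 0))"
      by (intro sum.cong) auto
    also have "\<dots> = (\<Sum>i=1..n. i * count \<mu> i) + x"
      using add.prems by (simp add: sum.distrib)
    finally show ?case
      using add by simp
  qed simp
  moreover have "set_mset \<nu> \<subseteq> {1..n}"
    using partition_part_bounds[OF assms] by blast
  ultimately show ?thesis
    using assms by (simp add: partitions_of_def)
qed

text \<open>With \<open>p n\<close> for the sum, deleting a part \<open>i\<close> gives \<open>n * p n = p (n - 1) + \<dots> + p 0\<close>.\<close>
lemma sum_partitions_recip:
  "(\<Sum>\<nu>\<in>partitions_of n. \<Prod>i=1..n. 1 / (fact (count \<nu> i) * real i ^ count \<nu> i)) = 1"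
proof -
  define w where "w = (\<lambda>N \<nu>. \<Prod>i=1..N. 1 / (fact (count \<nu> i) * real i ^ count \<nu> i))"
  \<comment> \<open>Absent parts contribute the factor 1, so weights of partitions of
    \<open>n - i\<close> and of \<open>n\<close> can be compared over the same range.\<close>
  have w_mono: "w N \<nu> = w n \<nu>" if "\<nu> \<in> partitions_of n" "n \<le> N" for N n \<nu>
    unfolding w_def
  proof (intro prod.mono_neutral_right ballI)
    fix i assume "i \<in> {1..N} - {1..n}"
    then have "i \<notin># \<nu>"
      using partition_part_bounds[OF that(1), of i] by auto
    then show "1 / (fact (count \<nu> i) * real i ^ count \<nu> i) = 1"
      by (simp add: not_in_iff)
  qed (use that in auto)
  have "(\<Sum>\<nu>\<in>partitions_of n. w n \<nu>) = 1"
  proof (induction n rule: less_induct)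
    case (less n)
    show ?case
    proof (cases "n = 0")
      case True
      have "partitions_of 0 = {{#}}"
        by (auto simp: partitions_of_def) (metis multiset_nonemptyE)
      then show ?thesis
        using True by (simp add: w_def)
    next
      case False
      have step: "(\<Sum>\<nu>\<in>partitions_of n. real (i * count \<nu> i) * w n \<nu>) = 1" if i: "i \<in> {1..n}" for i
      proof -
        have "(\<Sum>\<nu>\<in>partitions_of n. real (i * count \<nu> i) * w n \<nu>) =
            (\<Sum>\<nu>\<in>{\<nu> \<in> partitions_of n. i \<in># \<nu>}. real (i * count \<nu> i) * w n \<nu>)"
          by (intro sum.mono_neutral_right) (auto simp: not_in_iff)
        also have "\<dots> = (\<Sum>\<mu>\<in>partitions_of (n - i). real (i * count (add_mset i \<mu>) i) * w n (add_mset i \<mu>))"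
          by (rule sum.reindex_bij_witness[of _ "add_mset i" "\<lambda>\<nu>. \<nu> - {#i#}"])
            (use i in \<open>auto simp: partitions_of_def sum_mset_diff dest: in_diffD\<close>)
        also have "\<dots> = (\<Sum>\<mu>\<in>partitions_of (n - i). w (n - i) \<mu>)"
        proof (rule sum.cong[OF refl])
          fix \<mu> assume \<mu>: "\<mu> \<in> partitions_of (n - i)"
          let ?f = "\<lambda>\<nu> j. 1 / (fact (count \<nu> j) * real j ^ count \<nu> j) :: real"
          have "w n (add_mset i \<mu>) = ?f (add_mset i \<mu>) i * (\<Prod>j\<in>{1..n} - {i}. ?f (add_mset i \<mu>) j)"
            unfolding w_def using i by (intro prod.remove) auto
          also have "(\<Prod>j\<in>{1..n} - {i}. ?f (add_mset i \<mu>) j) = (\<Prod>j\<in>{1..n} - {i}. ?f \<mu> j)"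
            by (intro prod.cong) auto
          finally have split: "w n (add_mset i \<mu>) = ?f (add_mset i \<mu>) i * (\<Prod>j\<in>{1..n} - {i}. ?f \<mu> j)" .
          \<comment> \<open>The factor \<open>i\<close> times the multiplicity is what turns the
            weight of \<open>Suc c\<close> parts \<open>i\<close> into that of \<open>c\<close>
            parts.\<close>
          have "real (i * Suc c) * (1 / (fact (Suc c) * real i ^ Suc c)) = 1 / (fact c * real i ^ c)" for c
            using i by (simp add: fact_Suc divide_simps del: of_nat_Suc) (simp add: algebra_simps)
          from this[of "count \<mu> i"]
          have "real (i * count (add_mset i \<mu>) i) * ?f (add_mset i \<mu>) i = ?f \<mu> i"
            by simp
          then have "real (i * count (add_mset i \<mu>) i) * w n (add_mset i \<mu>) =
              ?f \<mu> i * (\<Prod>j\<in>{1..n} - {i}. ?f \<mu> j)"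
            unfolding split by (simp only: mult.assoc[symmetric])
          also have "\<dots> = w n \<mu>"
            unfolding w_def using i by (intro prod.remove[symmetric]) auto
          finally show "real (i * count (add_mset i \<mu>) i) * w n (add_mset i \<mu>) = w (n - i) \<mu>"
            using w_mono[OF \<mu>, of n] by simp
        qed
        also have "\<dots> = 1"
          using i False by (intro less) auto
        finally show ?thesis .
      qed
      have parts: "(\<Sum>i=1..n. real (i * count \<nu> i)) = real n" if "\<nu> \<in> partitions_of n" for \<nu>
        using sum_parts_eq[OF that] by (metis of_nat_sum)
      have "real n * (\<Sum>\<nu>\<in>partitions_of n. w n \<nu>) =
          (\<Sum>\<nu>\<in>partitions_of n. (\<Sum>i=1..n. real (i * count \<nu> i)) * w n \<nu>)"
        unfolding sum_distrib_left
        by (intro sum.cong refl) (simp only: parts)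
      also have "\<dots> = (\<Sum>i=1..n. \<Sum>\<nu>\<in>partitions_of n. real (i * count \<nu> i) * w n \<nu>)"
        unfolding sum_distrib_right by (rule sum.swap)
      also have "\<dots> = real n"
        using step by simp
      finally show ?thesis
        using False by simp
    qed
  qed
  then show ?thesis
    by (simp add: w_def)
qed

section \<open>From tuples to matrices: lower bounds for powers and non-powers\<close>

context GL_closure
begin

definition pow_tuples :: "nat \<Rightarrow> (nat \<Rightarrow> nat) \<Rightarrow> (nat \<times> nat \<Rightarrow> 'a) set" where
  "pow_tuples M m = {a \<in> unit_tuples m. generic m a \<and> (\<forall>t\<in>part_index m. a t \<in> K_powers M (fst t))}"

definition nonpow_tuples :: "nat \<Rightarrow> (nat \<Rightarrow> nat) \<Rightarrow> (nat \<times> nat \<Rightarrow> 'a) set" where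
  "nonpow_tuples M m = {a \<in> unit_tuples m. generic m a \<and> \<not> (\<forall>t\<in>part_index m. a t \<in> K_powers M (fst t))}"

text \<open>The reciprocal 1/g(\<lambda>): the exact proportion, among the unit tuples, of those
  with every entry an M-th power in its field.\<close>

definition gcd_weight :: "nat \<Rightarrow> (nat \<Rightarrow> nat) \<Rightarrow> real" where
  "gcd_weight M m = (\<Prod>i=1..n. 1 / real (gcd M (q ^ i - 1)) ^ m i)"

text \<open>This is z(\<lambda>), the order of the centralizer of a permutation of cycle type
  \<lambda>.\<close>

definition type_weight :: "(nat \<Rightarrow> nat) \<Rightarrow> nat" where
  "type_weight m = (\<Prod>i=1..n. fact (m i) * i ^ m i)"

lemma card_tuples_le:
  assumes A: "A \<subseteq> {a \<in> unit_tuples m. generic m a}"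
  shows "card A \<le> card (conjugates m ` A) * type_weight m"
proof (rule card_le_card_image_mult)
  show "finite A"
    by (rule finite_subset[OF A]) (simp add: finite_unit_tuples)
  fix S
  have "{a \<in> A. conjugates m a = S} \<subseteq> {a \<in> unit_tuples m. generic m a \<and> conjugates m a = S}"
    using A by blast
  then have "card {a \<in> A. conjugates m a = S} \<le> card {a \<in> unit_tuples m. generic m a \<and> conjugates m a = S}"
    using finite_unit_tuples by (intro card_mono) auto
  then show "card {a \<in> A. conjugates m a = S} \<le> type_weight m"
    using card_conjugates_fiber[of m S] by (simp add: type_weight_def)
qed

text \<open>\<open>e\<close> collects two losses relative to \<open>q ^ n\<close>: n/q for zero
  entries and n^2/q for tuples that are not generic. For the non-powers, the tuples of powers are
  subtracted with their exact count, so the same \<open>e\<close> serves.\<close>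

lemma card_pow_tuples:
  assumes m: "partition_of_n m" and M: "M \<ge> 1"
  defines "e \<equiv> real (n\<^sup>2 + n) / real q"
  shows "real q ^ n * (gcd_weight M m - e) \<le> card (pow_tuples M m)"
    and "real q ^ n * (1 - gcd_weight M m - e) \<le> card (nonpow_tuples M m)"
proof -
  let ?W = "PiE (part_index m) (\<lambda>t. K_powers M (fst t))" and ?N = "{a \<in> unit_tuples m. \<not> generic m a}"
  \<comment> \<open>The proportion of tuples without zero entries among all tuples from the fields
    \<open>K (fst t)\<close>.\<close>
  define p where "p = (\<Prod>t\<in>part_index m. 1 - 1 / real q ^ fst t)"
  define y where "y = gcd_weight M m"
  have q: "real q \<ge> 2" "real q > 0"
    using q_ge_2 by auto
  have WT: "?W \<subseteq> unit_tuples m"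
    unfolding unit_tuples_def using K_powers_subset_K_units by (intro PiE_mono) blast
  have finW: "finite ?W"
    using WT finite_unit_tuples finite_subset by blast
  have qi: "real (q ^ i - 1) = real q ^ i * (1 - 1 / real q ^ i)" for i
    using q_ge_2 by (simp add: of_nat_diff right_diff_distrib)
  have qn: "(\<Prod>t\<in>part_index m. real q ^ fst t) = real q ^ n"
    by (simp add: power_sum[symmetric] sum_part_index_fst[OF m])
  have "real (card (unit_tuples m)) = (\<Prod>t\<in>part_index m. real (q ^ fst t - 1))"
    unfolding unit_tuples_def using part_index_fst by (simp add: card_PiE[OF finite_part_index] card_K_units)
  also have "\<dots> = real q ^ n * p"
    unfolding qi p_def by (simp add: prod.distrib qn)
  finally have cT: "real (card (unit_tuples m)) = real q ^ n * p" .
  have "real (card (K_powers M i)) = real (q ^ i - 1) * (1 / real (gcd M (q ^ i - 1)))" if "i \<ge> 1" for i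
  proof -
    have "real (card (K_powers M i)) * real (gcd M (q ^ i - 1)) = real (q ^ i - 1)"
      using card_K_powers[OF that M] by (metis of_nat_mult)
    moreover have "real (gcd M (q ^ i - 1)) \<noteq> 0"
      using M by simp
    ultimately show ?thesis
      by (simp add: field_simps)
  qed
  then have "real (card ?W) = (\<Prod>t\<in>part_index m. real (q ^ fst t - 1) * (1 / real (gcd M (q ^ fst t - 1))))"
    using part_index_fst by (simp add: card_PiE[OF finite_part_index])
  also have "\<dots> = real q ^ n * p * (\<Prod>t\<in>part_index m. 1 / real (gcd M (q ^ fst t - 1)))"
    unfolding qi p_def by (simp only: prod.distrib qn)
  also have "(\<Prod>t\<in>part_index m. 1 / real (gcd M (q ^ fst t - 1))) = y"
    unfolding y_def gcd_weight_def using prod_part_index[of "\<lambda>i. 1 / real (gcd M (q ^ i - 1))" m]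
    by (simp add: power_one_over)
  finally have cW: "real (card ?W) = real q ^ n * p * y" .
  have "card (part_index m) \<le> (\<Sum>t\<in>part_index m. fst t)"
    using sum_mono[of "part_index m" "\<lambda>_. 1" fst] part_index_fst by simp
  then have cI: "card (part_index m) \<le> n"
    using sum_part_index_fst[OF m] by simp
  \<comment> \<open>Bernoulli's inequality with at most \<open>n\<close> parts, each factor of
    \<open>p\<close> being at least 1 - 1/q.\<close>
  have "1 - real n / real q \<le> 1 + real (card (part_index m)) * (- 1 / real q)"
    using cI q by (simp add: divide_right_mono)
  also have "\<dots> \<le> (1 + - 1 / real q) ^ card (part_index m)"
    using q by (intro Bernoulli_inequality) simp
  also have "\<dots> = (\<Prod>t\<in>part_index m. 1 - 1 / real q)"
    by simp
  also have "\<dots> \<le> p"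
    unfolding p_def
  proof (intro prod_mono conjI)
    fix t assume "t \<in> part_index m"
    then have "real q ^ 1 \<le> real q ^ fst t"
      using q part_index_fst by (intro power_increasing) auto
    then show "1 - 1 / real q \<le> 1 - 1 / real q ^ fst t"
      using q by (simp add: frac_le)
  qed (use q in simp)
  finally have p: "1 - real n / real q \<le> p" .
  have y: "0 \<le> y" "y \<le> 1"
  proof -
    have "1 \<le> gcd M (q ^ i - 1)" for i
      using M by (simp add: Suc_le_eq)
    then have g: "1 \<le> real (gcd M (q ^ i - 1)) ^ m i" for i
      by (metis of_nat_1 of_nat_le_iff one_le_power)
    show "0 \<le> y"
      unfolding y_def gcd_weight_def by (intro prod_nonneg) simp
    have "1 / x \<le> 1" if "1 \<le> x" for x :: real
      using that by simp
    from this[OF g] show "y \<le> 1"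
      unfolding y_def gcd_weight_def by (intro prod_le_1 conjI divide_nonneg_nonneg zero_le_power) auto
  qed
  have "real (card ?N) \<le> real (n\<^sup>2 * q ^ (n - 1))"
    using card_not_generic[OF m] by (rule of_nat_mono)
  also have "\<dots> = real q ^ n * (real (n\<^sup>2) / real q)"
  proof -
    have "real q ^ n = real q * real q ^ (n - 1)"
      using n_pos by (simp add: power_eq_if)
    then show ?thesis
      using q(2) by simp
  qed
  finally have cN: "real (card ?N) \<le> real q ^ n * (real (n\<^sup>2) / real q)" .
  have e: "e = real n / real q + real (n\<^sup>2) / real q"
    by (simp add: e_def add_divide_distrib)
  \<comment> \<open>Applied to both proportions, \<open>y\<close> and \<open>1 - y\<close>.\<close>
  have loss: "x - real n / real q \<le> p * x" if "0 \<le> x" "x \<le> 1" for x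
  proof -
    have "real n / real q * x \<le> real n / real q"
      using mult_left_le[OF that(2), of "real n / real q"] q by simp
    then have "x - real n / real q \<le> x - real n / real q * x"
      by linarith
    also have "\<dots> = (1 - real n / real q) * x"
      by (simp add: algebra_simps)
    also have "\<dots> \<le> p * x"
      using p that by (intro mult_right_mono)
    finally show ?thesis .
  qed
  have "?W \<subseteq> pow_tuples M m \<union> ?N"
    using WT unfolding pow_tuples_def by auto
  then have "card ?W \<le> card (pow_tuples M m \<union> ?N)"
    using finite_unit_tuples by (intro card_mono) (auto simp: pow_tuples_def)
  then have "card ?W \<le> card (pow_tuples M m) + card ?N"
    using card_Un_le le_trans by blast
  then have "real (card ?W) \<le> real (card (pow_tuples M m)) + real (card ?N)"
    by linarith
  moreover have "real q ^ n * (y - real n / real q) \<le> real q ^ n * (p * y)"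
    using loss[OF y] q by (intro mult_left_mono) auto
  ultimately show "real q ^ n * (gcd_weight M m - e) \<le> card (pow_tuples M m)"
    using cW cN unfolding e y_def[symmetric] by (simp add: algebra_simps)
  have "unit_tuples m \<subseteq> nonpow_tuples M m \<union> ?W \<union> ?N"
    unfolding nonpow_tuples_def unit_tuples_def by auto
  then have "card (unit_tuples m) \<le> card (nonpow_tuples M m \<union> ?W \<union> ?N)"
    using finite_unit_tuples finW by (intro card_mono) (auto simp: nonpow_tuples_def)
  also have "\<dots> \<le> card (nonpow_tuples M m) + card ?W + card ?N"
    using card_Un_le[of "nonpow_tuples M m \<union> ?W" ?N] card_Un_le[of "nonpow_tuples M m" ?W] by linarith
  finally have "real (card (unit_tuples m)) \<le> real (card (nonpow_tuples M m)) + real (card ?W) + real (card ?N)"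
    by linarith
  moreover have "real q ^ n * (1 - y - real n / real q) \<le> real q ^ n * (p * (1 - y))"
    using loss[of "1 - y"] y q by (intro mult_left_mono) auto
  ultimately show "real q ^ n * (1 - gcd_weight M m - e) \<le> card (nonpow_tuples M m)"
    using cT cW cN unfolding e y_def[symmetric] by (simp add: algebra_simps)
qed

text \<open>Classes of different sets are disjoint, so their sizes, each at least |GL|/q^n, add up
  inside \<open>A\<close>.\<close>

lemma card_le_union_conj_class:
  assumes fin: "finite \<S>" "finite A" and S: "\<And>S. S \<in> \<S> \<Longrightarrow> frob_set S \<and> conj_class S \<subseteq> A"
  shows "card (carrier G) * card \<S> \<le> card A * q ^ n"
proof -
  have "card (carrier G) * card \<S> = (\<Sum>S\<in>\<S>. card (carrier G))"
    by simp
  also have "\<dots> \<le> (\<Sum>S\<in>\<S>. card (conj_class S) * q ^ n)"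
    using card_conj_class S by (intro sum_mono) blast
  also have "\<dots> = (\<Sum>S\<in>\<S>. card (conj_class S)) * q ^ n"
    by (simp add: sum_distrib_right)
  also have "(\<Sum>S\<in>\<S>. card (conj_class S)) = card (\<Union>S\<in>\<S>. conj_class S)"
  proof (rule card_UN_disjoint[symmetric])
    show "\<forall>S\<in>\<S>. finite (conj_class S)"
      using S fin(2) finite_subset by blast
    show "\<forall>S\<in>\<S>. \<forall>S'\<in>\<S>. S \<noteq> S' \<longrightarrow> conj_class S \<inter> conj_class S' = {}"
      using conj_class_disjoint S by blast
  qed (rule fin)
  also have "\<dots> \<le> card A"
    using S fin(2) by (intro card_mono) auto
  finally show ?thesis
    by simp
qed

lemma partition_of_n_count: "\<nu> \<in> partitions_of n \<Longrightarrow> partition_of_n (count \<nu>)"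
  unfolding partition_of_n_def by (rule sum_parts_eq)

text \<open>The common passage from tuples to matrices, applied once to the powers and once to the
  non-powers. A set of eigenvalues arises from at most \<open>type_weight\<close> tuples and carries
  one class.\<close>

lemma sum_classes_le:
  assumes tup: "\<And>\<nu>. \<nu> \<in> partitions_of n \<Longrightarrow> B \<nu> \<subseteq> {a \<in> unit_tuples (count \<nu>). generic (count \<nu>) a}"
    and conj_class: "\<And>\<nu> a. \<nu> \<in> partitions_of n \<Longrightarrow> a \<in> B \<nu> \<Longrightarrow> conj_class (conjugates (count \<nu>) a) \<subseteq> A" and A: "finite A"
    and bound: "\<And>\<nu>. \<nu> \<in> partitions_of n \<Longrightarrow> real q ^ n * b \<nu> \<le> card (B \<nu>)"
  shows "real (card (carrier G)) * (\<Sum>\<nu>\<in>partitions_of n. b \<nu> / real (type_weight (count \<nu>))) \<le> real (card A)"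
proof -
  let ?P = "partitions_of n"
  define Ob where "Ob = (\<lambda>\<nu>. conjugates (count \<nu>) ` B \<nu>)"
  have finB: "finite (B \<nu>)" if "\<nu> \<in> ?P" for \<nu>
    by (rule finite_subset[OF tup[OF that]]) (simp add: finite_unit_tuples)
  have z: "real (type_weight m) > 0" for m
    by (auto simp: type_weight_def intro!: prod_pos)
  have q: "real q ^ n > 0"
    using q_ge_2 by simp
  \<comment> \<open>The set of eigenvalues determines the multiplicities on \<open>{1..n}\<close>,
    and these determine the partition.\<close>
  have disj: "Ob \<nu> \<inter> Ob \<mu> = {}" if "\<nu> \<in> ?P" "\<mu> \<in> ?P" "\<nu> \<noteq> \<mu>" for \<nu> \<mu>
  proof (rule ccontr)
    assume "Ob \<nu> \<inter> Ob \<mu> \<noteq> {}"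
    then obtain a b where a: "a \<in> B \<nu>" and b: "b \<in> B \<mu>" and eq: "conjugates (count \<nu>) a = conjugates (count \<mu>) b"
      unfolding Ob_def by blast
    have "count \<nu> i = count \<mu> i" if i: "i \<in> {1..n}" for i
      using conjugates_eq_imp_type_eq[OF _ _ _ _ eq i] a b tup \<open>\<nu> \<in> ?P\<close> \<open>\<mu> \<in> ?P\<close> by blast
    moreover have "count \<nu> i = count \<mu> i" if "i \<notin> {1..n}" for i
      using partition_part_bounds \<open>\<nu> \<in> ?P\<close> \<open>\<mu> \<in> ?P\<close> that by (metis not_in_iff)
    ultimately have "\<nu> = \<mu>"
      by (intro multiset_eqI) blast
    then show False
      using that(3) by simp
  qed
  have "card (\<Union>\<nu>\<in>?P. Ob \<nu>) = (\<Sum>\<nu>\<in>?P. card (Ob \<nu>))"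
    using disj finB by (intro card_UN_disjoint) (auto simp: Ob_def)
  moreover have "card (carrier G) * card (\<Union>\<nu>\<in>?P. Ob \<nu>) \<le> card A * q ^ n"
  proof (rule card_le_union_conj_class[OF _ A])
    show "finite (\<Union>\<nu>\<in>?P. Ob \<nu>)"
      using finB by (auto simp: Ob_def)
    fix S assume "S \<in> (\<Union>\<nu>\<in>?P. Ob \<nu>)"
    then obtain \<nu> a where a: "\<nu> \<in> ?P" "a \<in> B \<nu>" "S = conjugates (count \<nu>) a"
      by (auto simp: Ob_def)
    then show "frob_set S \<and> conj_class S \<subseteq> A"
      using frob_set_conjugates[OF partition_of_n_count[OF a(1)]] tup[OF a(1)] conj_class[OF a(1,2)] by blast
  qed
  ultimately have "real (card (carrier G)) * (\<Sum>\<nu>\<in>?P. real (card (Ob \<nu>))) \<le> real (card A) * real q ^ n"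
    by (metis of_nat_mono of_nat_mult of_nat_power of_nat_sum)
  moreover have "(\<Sum>\<nu>\<in>?P. real q ^ n * (b \<nu> / real (type_weight (count \<nu>)))) \<le> (\<Sum>\<nu>\<in>?P. real (card (Ob \<nu>)))"
  proof (rule sum_mono)
    fix \<nu> assume \<nu>: "\<nu> \<in> ?P"
    have "real (card (B \<nu>)) \<le> real (card (Ob \<nu>)) * real (type_weight (count \<nu>))"
      using card_tuples_le[OF tup[OF \<nu>]] unfolding Ob_def by (metis of_nat_mono of_nat_mult)
    then have "real q ^ n * b \<nu> \<le> real (card (Ob \<nu>)) * real (type_weight (count \<nu>))"
      using bound[OF \<nu>] by linarith
    then show "real q ^ n * (b \<nu> / real (type_weight (count \<nu>))) \<le> real (card (Ob \<nu>))"
      using z[of "count \<nu>"] by (simp add: divide_le_eq)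
  qed
  moreover define s where "s = (\<Sum>\<nu>\<in>?P. b \<nu> / real (type_weight (count \<nu>)))"
  ultimately have "real q ^ n * s \<le> (\<Sum>\<nu>\<in>?P. real (card (Ob \<nu>)))"
    and le: "real (card (carrier G)) * (\<Sum>\<nu>\<in>?P. real (card (Ob \<nu>))) \<le> real (card A) * real q ^ n"
    by (simp_all only: sum_distrib_left)
  then have "real (card (carrier G)) * (real q ^ n * s) \<le> real (card (carrier G)) * (\<Sum>\<nu>\<in>?P. real (card (Ob \<nu>)))"
    by (intro mult_left_mono) simp_all
  also note le
  finally have "real (card (carrier G)) * (real q ^ n * s) \<le> real (card A) * real q ^ n" .
  then have "real q ^ n * (real (card (carrier G)) * s) \<le> real q ^ n * real (card A)"
    by (simp only: mult_ac)
  then show ?thesis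
    using q unfolding s_def by (simp only: mult_le_cancel_left_pos)
qed

lemma power_image_proportion:
  assumes M: "M \<ge> 1"
  shows "\<bar>real (card (power_image G M)) / real (card (carrier G))
        - (\<Sum>\<nu>\<in>partitions_of n. gcd_weight M (count \<nu>) / real (type_weight (count \<nu>)))\<bar>
      \<le> real (n\<^sup>2 + n) / real q"
proof -
  let ?P = "partitions_of n" and ?y = "\<lambda>\<nu>. gcd_weight M (count \<nu>)" and ?z = "\<lambda>\<nu>. real (type_weight (count \<nu>))"
  define e where "e = real (n\<^sup>2 + n) / real q"
  define N where "N = real (card (carrier G))"
  have N: "N > 0"
    using finite_G G.one_closed unfolding N_def by (auto simp: card_gt_0_iff)
  have sub: "power_image G M \<subseteq> carrier G"
    by (auto simp: power_image_def)
  have fin: "finite (power_image G M)"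
    using sub finite_G finite_subset by blast
  have "(\<Sum>\<nu>\<in>?P. 1 / ?z \<nu>) = 1"
    using sum_partitions_recip[of n] by (simp add: type_weight_def prod_dividef)
  \<comment> \<open>The weights \<open>1 / ?z \<nu>\<close> form a probability distribution, so the
    constants 1 and \<open>e\<close> pass through the sums unchanged.\<close>
  then have z1: "(\<Sum>\<nu>\<in>?P. c / ?z \<nu>) = c" for c
    by (simp add: divide_inverse sum_distrib_left[symmetric])
  have "N * (\<Sum>\<nu>\<in>?P. (?y \<nu> - e) / ?z \<nu>) \<le> card (power_image G M)"
    unfolding N_def
  proof (rule sum_classes_le[where B = "\<lambda>\<nu>. pow_tuples M (count \<nu>)"])
    fix \<nu> a assume \<nu>: "\<nu> \<in> ?P" and "a \<in> pow_tuples M (count \<nu>)"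
    then have a: "a \<in> unit_tuples (count \<nu>)" "generic (count \<nu>) a" "\<And>t. t \<in> part_index (count \<nu>) \<Longrightarrow> a t \<in> K_powers M (fst t)"
      by (auto simp: pow_tuples_def)
    obtain c where "c \<in> equivariant (conjugates (count \<nu>) a)" "\<And>b. b \<in> conjugates (count \<nu>) a \<Longrightarrow> c b [^] M = b"
      using powers_imp_equivariant[OF a] by blast
    then show "conj_class (conjugates (count \<nu>) a) \<subseteq> power_image G M"
      by (rule conj_class_powers[OF frob_set_conjugates[OF partition_of_n_count[OF \<nu>] a(1,2)] _ _ M])
  next
    fix \<nu> assume "\<nu> \<in> ?P"
    then show "real q ^ n * (?y \<nu> - e) \<le> card (pow_tuples M (count \<nu>))"
      unfolding e_def by (intro card_pow_tuples(1) partition_of_n_count M)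
  qed (auto simp: pow_tuples_def fin)
  moreover have "(\<Sum>\<nu>\<in>?P. (?y \<nu> - e) / ?z \<nu>) = (\<Sum>\<nu>\<in>?P. ?y \<nu> / ?z \<nu>) - e"
    by (simp add: diff_divide_distrib sum_subtractf z1)
  ultimately have lower: "N * ((\<Sum>\<nu>\<in>?P. ?y \<nu> / ?z \<nu>) - e) \<le> card (power_image G M)"
    by simp
  have "N * (\<Sum>\<nu>\<in>?P. (1 - ?y \<nu> - e) / ?z \<nu>) \<le> card (carrier G - power_image G M)"
    unfolding N_def
  proof (rule sum_classes_le[where B = "\<lambda>\<nu>. nonpow_tuples M (count \<nu>)"])
    fix \<nu> a assume \<nu>: "\<nu> \<in> ?P" and "a \<in> nonpow_tuples M (count \<nu>)"
    then have a: "a \<in> unit_tuples (count \<nu>)" "generic (count \<nu>) a" and nt: "\<not> (\<forall>t\<in>part_index (count \<nu>). a t \<in> K_powers M (fst t))"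
      by (auto simp: nonpow_tuples_def)
    note S = frob_set_conjugates[OF partition_of_n_count[OF \<nu>] a]
    have "conj_class (conjugates (count \<nu>) a) \<inter> power_image G M = {}"
    proof (rule ccontr)
      assume "conj_class (conjugates (count \<nu>) a) \<inter> power_image G M \<noteq> {}"
      then obtain c where "c \<in> equivariant (conjugates (count \<nu>) a)" "\<And>b. b \<in> conjugates (count \<nu>) a \<Longrightarrow> c b [^] M = b"
        using powers_conj_class[OF S] by blast
      then show False
        using equivariant_imp_powers[OF a(1) M] nt by blast
    qed
    then show "conj_class (conjugates (count \<nu>) a) \<subseteq> carrier G - power_image G M"
      using conj_class_carrier[OF S] by blast
  next
    fix \<nu> assume "\<nu> \<in> ?P"
    then show "real q ^ n * (1 - ?y \<nu> - e) \<le> card (nonpow_tuples M (count \<nu>))"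
      unfolding e_def by (intro card_pow_tuples(2) partition_of_n_count M)
  qed (auto simp: nonpow_tuples_def finite_G)
  moreover have "(\<Sum>\<nu>\<in>?P. (1 - ?y \<nu> - e) / ?z \<nu>) = 1 - (\<Sum>\<nu>\<in>?P. ?y \<nu> / ?z \<nu>) - e"
    by (simp only: diff_divide_distrib sum_subtractf z1)
  moreover have "real (card (carrier G - power_image G M)) = N - real (card (power_image G M))"
    using card_Diff_subset[OF fin sub] card_mono[OF finite_G sub] by (simp add: N_def of_nat_diff)
  ultimately have upper: "N * (1 - (\<Sum>\<nu>\<in>?P. ?y \<nu> / ?z \<nu>) - e) \<le> N - card (power_image G M)"
    by simp
  have "(\<Sum>\<nu>\<in>?P. ?y \<nu> / ?z \<nu>) - e \<le> card (power_image G M) / N"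
    using lower N by (simp add: le_divide_eq mult.commute)
  moreover have "card (power_image G M) / N \<le> (\<Sum>\<nu>\<in>?P. ?y \<nu> / ?z \<nu>) + e"
    using upper N by (simp add: divide_le_eq algebra_simps)
  ultimately show ?thesis
    unfolding e_def[symmetric] N_def[symmetric] by (simp add: abs_le_iff)
qed

end

theorem proposition4p1:
  fixes n M :: nat
  assumes "n \<ge> 1" and "M \<ge> 2"
  shows "\<exists>C::real. \<forall>q::nat. primepow q \<longrightarrow>
    (\<forall>F :: 'a ring. field F \<and> finite (carrier F) \<and> card (carrier F) = q \<longrightarrow>
      \<bar>real (card (power_image (GL n F) M)) / real (card (carrier (GL n F)))
        - (\<Sum>\<nu>\<in>partitions_of n. \<Prod>i=1..n.
             1 / (fact (count \<nu> i) * real i ^ count \<nu> i * real (gcd M (q ^ i - 1)) ^ count \<nu> i))\<bar>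
      \<le> C * (1 / real q))"
proof (intro exI[of _ "real (n\<^sup>2 + n)"] allI impI, elim conjE)
  fix q :: nat and F :: "'a ring"
  assume F: "field F" "finite (carrier F)" "card (carrier F) = q"
  interpret F: field F by fact
  \<comment> \<open>The closure has elements of a different type and comes with an embedding of
    \<open>F\<close>, which plays the role of \<open>h\<close>.\<close>
  obtain L :: "(('a list \<times> nat) multiset \<Rightarrow> 'a) ring"
    where L: "algebraic_closure L (F.indexed_const ` carrier F)"
    and h: "F.indexed_const \<in> ring_hom F L"
    by (rule F.exists_closure)
  interpret L: algebraic_closure L "F.indexed_const ` carrier F" by fact
  interpret E: finite_field_ext F L F.indexed_const q
    by unfold_locales (simp_all only: h F)
  interpret E: GL_closure F L F.indexed_const q n
    by unfold_locales (fact assms(1) E.card_K[OF L.algebraically_closed_axioms])+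
  have "E.gcd_weight M m / real (E.type_weight m) =
      (\<Prod>i=1..n. 1 / (fact (m i) * real i ^ m i * real (gcd M (q ^ i - 1)) ^ m i))" for m
  proof -
    have "real (E.type_weight m) = (\<Prod>i=1..n. fact (m i) * real i ^ m i)"
      by (simp add: E.type_weight_def)
    then have "E.gcd_weight M m / real (E.type_weight m) =
        (\<Prod>i=1..n. 1 / real (gcd M (q ^ i - 1)) ^ m i / (fact (m i) * real i ^ m i))"
      by (simp only: E.gcd_weight_def prod_dividef)
    then show ?thesis
      by (simp only: divide_divide_eq_left mult_ac)
  qed
  then show "\<bar>real (card (power_image (GL n F) M)) / real (card (carrier (GL n F)))
        - (\<Sum>\<nu>\<in>partitions_of n. \<Prod>i=1..n.
             1 / (fact (count \<nu> i) * real i ^ count \<nu> i * real (gcd M (q ^ i - 1)) ^ count \<nu> i))\<bar>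
      \<le> real (n\<^sup>2 + n) * (1 / real q)"
    using E.power_image_proportion[of M] assms(2) by simp
qed

end
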